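(* Let $n,d\in\mathbb N=\{1,2,\dots\}$. The cone $(\Sigma+C)_{n,2d}$ is closed under linear transformations of variables if and only if $(n,2d)$ is a Hilbert case.
   Context: The Hilbert cases are the pairs $(n,2d)\in\{(2,2d),(n,2),(3,4)\}$, i.e. those with $n=2$, or $2d=2$, or $(n,2d)=(3,4)$. A cone $K\subseteq H_{n,2d}$ is closed under linear transformations of variables if $f(A\cdot x)\in K$ for all $f\in K$ and all $A\in\mathbb R^{n\times n}$, where $x=(x_1,\dots,x_n)^T$. $H_{n,k}$ is the real vector space of forms of degree $k$ in $n$ variables. $\Sigma_{n,2d}\subseteq H_{n,2d}$ is the set of finite sums of squares of forms in $H_{n,d}$. For $f=\sum_\alpha f_\alpha x^\alpha\in H_{n,2d}$: $\operatorname{supp}(f)=\{\alpha\in\mathbb N_0^n:f_\alpha\neq0\}$, $\operatorname{New}(f)=\operatorname{conv}(\operatorname{supp}(f))$, $V(f)$ is the vertex set of $\operatorname{New}(f)$, $\mathcal S(f)=\{\alpha\in\operatorname{supp}(f):\alpha\in(2\mathbb N_0)^n,\ f_\alpha>0\}$, $\mathcal I(f)=\operatorname{supp}(f)\setminus\mathcal S(f)$. A form $f\in H_{n,2d}$ is a circuit if $\mathcal S(f)=V(f)$, $V(f)$ is affinely independent (single points and the empty set count as affinely independent), and either $\mathcal I(f)=\emptyset$ or $\mathcal I(f)=\{\beta\}$ with $\beta$ in the relative interior of $\operatorname{New}(f)$. It is a nonnegative circuit if moreover $f\ge0$ on $\mathbb R^n$. $C_{n,2d}$ is the set of all finite sums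 of nonnegative circuits in $H_{n,2d}$. $(\Sigma+C)_{n,2d}=\{g+h: g\in\Sigma_{n,2d},\ h\in C_{n,2d}\}$.
   Formalization: The case n = 1 is added to the right-hand side: the cone is closed iff (n,2d) is a Hilbert case or n = 1; for n = 1, d ≥ 2 the cone {c x^{2d} : c ≥ 0} is closed although (1,2d) is not a listed Hilbert case. *)

theory Defs
  imports "HOL-Analysis.Analysis" "HOL-Library.Poly_Mapping"
begin

text \<open>
  A real polynomial in the variables \<open>x_i\<close>, \<open>i :: 'n\<close>, is a finitely supported map from
  exponents \<open>'n \<Rightarrow>\<^sub>0 nat\<close> to coefficients, with the convolution product of
  \<^theory>\<open>HOL-Library.Poly_Mapping\<close>. The number \<open>n\<close> of variables is \<open>CARD('n)\<close>, so that
  \<open>n \<ge> 1\<close> holds automatically.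
\<close>

type_synonym 'n rpoly = "('n \<Rightarrow>\<^sub>0 nat) \<Rightarrow>\<^sub>0 real"

definition supp :: "'n rpoly \<Rightarrow> ('n \<Rightarrow>\<^sub>0 nat) set" where
  "supp f = Poly_Mapping.keys f"

definition coeff :: "'n rpoly \<Rightarrow> ('n \<Rightarrow>\<^sub>0 nat) \<Rightarrow> real" where
  "coeff f \<alpha> = Poly_Mapping.lookup f \<alpha>"

definition const :: "real \<Rightarrow> 'n rpoly" where
  "const c = Poly_Mapping.single 0 c"

definition var :: "'n \<Rightarrow> 'n rpoly" where
  "var i = Poly_Mapping.single (Poly_Mapping.single i 1) 1"

definition eval :: "'n::finite rpoly \<Rightarrow> real^'n \<Rightarrow> real" where
  "eval f x = (\<Sum>\<alpha>\<in>supp f. coeff f \<alpha> * (\<Prod>i\<in>UNIV. (x $ i) ^ Poly_Mapping.lookup \<alpha> i))"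

definition forms :: "nat \<Rightarrow> 'n::finite rpoly set" where
  "forms k = {f. \<forall>\<alpha>\<in>supp f. (\<Sum>i\<in>UNIV. Poly_Mapping.lookup \<alpha> i) = k}"

text \<open>The polynomial \<open>f(A \<cdot> x)\<close>; see lemma \<open>eval_lin_subst\<close> below.\<close>

definition lin_subst :: "real^'n^'n \<Rightarrow> 'n::finite rpoly \<Rightarrow> 'n rpoly" where
  "lin_subst A f = (\<Sum>\<alpha>\<in>supp f. const (coeff f \<alpha>) *
     (\<Prod>i\<in>UNIV. (\<Sum>j\<in>UNIV. const (A $ i $ j) * var j) ^ Poly_Mapping.lookup \<alpha> i))"

definition closed_under_linear_transformations :: "'n::finite rpoly set \<Rightarrow> bool" where
  "closed_under_linear_transformations K \<longleftrightarrow> (\<forall>f\<in>K. \<forall>A. lin_subst A f \<in> K)"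

text \<open>Exponents as points of Euclidean space, for the convex geometry of Newton polytopes.\<close>

definition expvec :: "('n::finite \<Rightarrow>\<^sub>0 nat) \<Rightarrow> real^'n" where
  "expvec \<alpha> = (\<chi> i. real (Poly_Mapping.lookup \<alpha> i))"

definition New :: "'n::finite rpoly \<Rightarrow> (real^'n) set" where
  "New f = convex hull (expvec ` supp f)"

definition New_vertices :: "'n::finite rpoly \<Rightarrow> (real^'n) set" where
  "New_vertices f = {v. v extreme_point_of New f}"

definition S_supp :: "'n::finite rpoly \<Rightarrow> ('n \<Rightarrow>\<^sub>0 nat) set" where
  "S_supp f = {\<alpha>\<in>supp f. (\<forall>i. even (Poly_Mapping.lookup \<alpha> i)) \<and> coeff f \<alpha> > 0}"

definition I_supp :: "'n::finite rpoly \<Rightarrow> ('n \<Rightarrow>\<^sub>0 nat) set" where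
  "I_supp f = supp f - S_supp f"

definition circuit :: "'n::finite rpoly \<Rightarrow> bool" where
  "circuit f \<longleftrightarrow>
     expvec ` S_supp f = New_vertices f \<and>
     \<not> affine_dependent (New_vertices f) \<and>
     (I_supp f = {} \<or> (\<exists>\<beta>. I_supp f = {\<beta>} \<and> expvec \<beta> \<in> rel_interior (New f)))"

definition nonneg_circuit :: "'n::finite rpoly \<Rightarrow> bool" where
  "nonneg_circuit f \<longleftrightarrow> circuit f \<and> (\<forall>x. eval f x \<ge> 0)"

text \<open>The cones \<open>\<Sigma>\<close>, \<open>C\<close> and \<open>\<Sigma> + C\<close> take the full (even) degree as argument.
  The finite sums may be empty, which only yields the zero form.\<close>

definition SOS :: "nat \<Rightarrow> 'n::finite rpoly set" where
  "SOS k = {f. \<exists>gs. set gs \<subseteq> forms (k div 2) \<and> f = sum_list (map (\<lambda>g. g ^ 2) gs)}"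

definition SONC :: "nat \<Rightarrow> 'n::finite rpoly set" where
  "SONC k = {f. \<exists>hs. set hs \<subseteq> {h \<in> forms k. nonneg_circuit h} \<and> f = sum_list hs}"

definition SOS_plus_SONC :: "nat \<Rightarrow> 'n::finite rpoly set" where
  "SOS_plus_SONC k = {g + h | g h. g \<in> SOS k \<and> h \<in> SONC k}"

text \<open>
  This does not cover \<open>n = 1\<close>, \<open>k \<ge> 4\<close>, although there \<open>\<Sigma> + C\<close> consists of the nonnegative
  multiples of \<open>x\<^sup>k\<close> and so is closed under linear transformations; \<open>n = 1\<close> has to be
  treated separately.
\<close>

definition hilbert_case :: "nat \<Rightarrow> nat \<Rightarrow> bool" where
  "hilbert_case n k \<longleftrightarrow> n = 2 \<or> k = 2 \<or> (n = 3 \<and> k = 4)"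


lemma eval_superset:
  assumes "finite S" "supp f \<subseteq> S"
  shows "eval f x = (\<Sum>\<alpha>\<in>S. coeff f \<alpha> * (\<Prod>i\<in>UNIV. (x $ i) ^ Poly_Mapping.lookup \<alpha> i))"
  unfolding eval_def
  by (rule sum.mono_neutral_left) (use assms in \<open>auto simp: supp_def coeff_def in_keys_iff\<close>)

lemma eval_add: "eval (f + g) x = eval f x + eval g x"
proof -
  let ?S = "supp f \<union> supp g"
  have *: "finite ?S" "supp (f + g) \<subseteq> ?S" "supp f \<subseteq> ?S" "supp g \<subseteq> ?S"
    using Poly_Mapping.keys_add[of f g] by (auto simp: supp_def)
  show ?thesis
    using eval_superset[OF *(1,2), of x] eval_superset[OF *(1,3), of x] eval_superset[OF *(1,4), of x]
    by (simp add: coeff_def lookup_add ring_distribs sum.distrib)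
qed

lemma eval_zero [simp]: "eval 0 x = 0"
  by (simp add: eval_def supp_def)

lemma eval_single:
  "eval (Poly_Mapping.single \<alpha> c) x = c * (\<Prod>i\<in>UNIV. (x $ i) ^ Poly_Mapping.lookup \<alpha> i)"
  using eval_superset[of "{\<alpha>}" "Poly_Mapping.single \<alpha> c" x]
  by (simp add: supp_def coeff_def)

lemma eval_const [simp]: "eval (const c) x = c"
  by (simp add: const_def eval_single)

lemma eval_var [simp]: "eval (var i) x = x $ i"
proof -
  have "(\<Prod>j\<in>UNIV. (x $ j) ^ Poly_Mapping.lookup (Poly_Mapping.single i 1) j)
      = (\<Prod>j\<in>UNIV. if i = j then x $ j else 1)"
    by (rule prod.cong) (auto simp: lookup_single when_def)
  then show ?thesis
    by (simp add: var_def eval_single)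
qed

lemma eval_sum: "eval (\<Sum>a\<in>S. f a) x = (\<Sum>a\<in>S. eval (f a) x)"
  by (induction S rule: infinite_finite_induct) (auto simp: eval_add)

lemma rpoly_as_sum: "f = (\<Sum>\<alpha>\<in>supp f. Poly_Mapping.single \<alpha> (coeff f \<alpha>))"
proof (rule poly_mapping_eqI)
  fix \<gamma>
  have "(\<Sum>\<alpha>\<in>supp f. Poly_Mapping.lookup (Poly_Mapping.single \<alpha> (coeff f \<alpha>)) \<gamma>)
      = (\<Sum>\<alpha>\<in>supp f. if \<alpha> = \<gamma> then coeff f \<gamma> else 0)"
    by (rule sum.cong) (auto simp: lookup_single when_def)
  also have "\<dots> = coeff f \<gamma>"
    by (simp add: supp_def coeff_def in_keys_iff)
  finally show "Poly_Mapping.lookup f \<gamma>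
      = Poly_Mapping.lookup (\<Sum>\<alpha>\<in>supp f. Poly_Mapping.single \<alpha> (coeff f \<alpha>)) \<gamma>"
    by (simp add: lookup_sum coeff_def)
qed

lemma eval_mult: "eval (f * g) x = eval f x * eval g x"
proof -
  have "f * g = (\<Sum>\<alpha>\<in>supp f. \<Sum>\<beta>\<in>supp g.
      Poly_Mapping.single (\<alpha> + \<beta>) (coeff f \<alpha> * coeff g \<beta>))"
    by (subst rpoly_as_sum[of f], subst rpoly_as_sum[of g])
      (simp add: sum_product mult_single)
  then show ?thesis
    by (simp add: eval_sum eval_single lookup_add power_add prod.distrib)
      (simp add: eval_def sum_product mult_ac)
qed

lemma eval_one [simp]: "eval 1 x = 1"
  using eval_const[of 1 x] by (simp add: const_def)

lemma eval_power: "eval (f ^ k) x = eval f x ^ k"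
  by (induction k) (auto simp: eval_mult)

lemma eval_prod: "eval (\<Prod>a\<in>S. f a) x = (\<Prod>a\<in>S. eval (f a) x)"
  by (induction S rule: infinite_finite_induct) (auto simp: eval_mult)

lemma eval_lin_subst: "eval (lin_subst A f) x = eval f (A *v x)"
  by (simp add: lin_subst_def eval_sum eval_mult eval_prod eval_power)
    (simp add: eval_def matrix_vector_mult_def)

end

theory Submission
  imports Defs "HOL-Computational_Algebra.Polynomial" "HOL-Computational_Algebra.Primes"
begin

text \<open>
  In the Hilbert cases every nonnegative circuit is a sum of squares, so \<open>\<Sigma> + C = \<Sigma>\<close>: the interior
  exponent \<open>\<beta>\<close> involves either two variables, and then the whole circuit does, so that it is
  a nonnegative binary form, or \<open>\<beta>\<close> is \<open>(2,1,1)\<close> up to permutation, and then there are only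
  five possible Newton polytopes.

  Outside the Hilbert cases take a nonnegative circuit \<open>f\<close> that is not a sum of squares
  (Motzkin's form times a power of a variable, or the quartic of Choi and Lam) and move two of its
  real zeros to \<open>(1,\<dots>,1)\<close> and to a vector of distinct primes by an invertible linear map.
  No nonzero nonnegative circuit vanishes at both of these points, so if \<open>f(A \<cdot> x)\<close> were in
  \<open>\<Sigma> + C\<close> it would be in \<open>\<Sigma>\<close>, and so would \<open>f\<close>.
\<close>

section \<open>Polynomials, forms and sums of squares\<close>

text \<open>Nonmembership in Sigma + C is hard to test directly, so the proof forces the circuit
  part of a decomposition to vanish. At a zero of f(A x) every summand vanishes, because all of them
  are nonnegative. In logarithmic coordinates on the positive orthant, a circuit with interior
  exponent \<beta> is a monomial times a convex function, and its zeros there form an affine space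
  orthogonal to all differences of its exponents. One zero such as (1,...,1) is therefore harmless,
  and a second one must not have logarithms orthogonal to any such difference. Logarithms of
  distinct primes are linearly independent over the rationals, which rules this out for all circuits
  at once. An invertible map can reach these two points exactly when the chosen zeros of f are
  linearly independent.

  In the other direction, Hilbert's theorem on ternary quartics is bypassed: for each of the five
  polytopes the circuit is governed by a binary quadratic form in suitable monomials, after
  splitting off at most one explicit square.\<close>

abbreviation lookup :: "('a \<Rightarrow>\<^sub>0 'b::zero) \<Rightarrow> 'a \<Rightarrow> 'b" where
  "lookup \<equiv> Poly_Mapping.lookup"

lemma expvec_nth [simp]: "expvec \<alpha> $ i = real (lookup \<alpha> i)"
  by (simp add: expvec_def)

lemma inj_expvec: "inj expvec"
  by (rule injI) (auto simp: vec_eq_iff intro: poly_mapping_eqI)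

lemma finite_supp [simp]: "finite (supp f)"
  by (simp add: supp_def)

lemma in_supp_iff: "\<alpha> \<in> supp f \<longleftrightarrow> coeff f \<alpha> \<noteq> 0"
  by (simp add: supp_def coeff_def in_keys_iff)

lemma eval_uminus: "eval (- f) x = - eval f x"
  using eval_add[of f "- f" x] by simp

lemma eval_sum_list: "eval (sum_list fs) x = (\<Sum>f\<leftarrow>fs. eval f x)"
  by (induction fs) (auto simp: eval_add)

text \<open>One fixed vector of distinct primes serves twice: unique factorization separates the
  values of all monomials at it, both for identifying a polynomial with its function and for
  excluding circuits.\<close>

definition primes_of :: "'n::finite \<Rightarrow> nat" where
  "primes_of = (SOME p. inj p \<and> (\<forall>i. prime (p i)))"

lemma inj_primes_of: "inj (primes_of :: 'n::finite \<Rightarrow> nat)"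
  and prime_primes_of: "prime (primes_of (i :: 'n))"
proof -
  obtain B where B: "B \<subseteq> {p::nat. prime p}" "finite B" "card B = CARD('n)"
    using infinite_arbitrarily_large[OF primes_infinite] by blast
  then obtain h :: "'n \<Rightarrow> nat" where "bij_betw h UNIV B"
    using finite_same_card_bij[of "UNIV :: 'n set" B] by auto
  then have "\<exists>p :: 'n \<Rightarrow> nat. inj p \<and> (\<forall>i. prime (p i))"
    using B(1) unfolding bij_betw_def by (intro exI[of _ h]) auto
  then have "inj (primes_of :: 'n \<Rightarrow> nat) \<and> (\<forall>i :: 'n. prime (primes_of i))"
    unfolding primes_of_def by (rule someI_ex)
  then show "inj (primes_of :: 'n \<Rightarrow> nat)" "prime (primes_of i)"
    by auto
qed

lemma primes_of_pos [simp]: "primes_of i > 0"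
  using prime_primes_of[of i] by (simp add: prime_gt_0_nat)

lemma prime_power_prod_inj:
  assumes "(\<Prod>i\<in>UNIV. primes_of (i :: 'n::finite) ^ lookup \<alpha> i) =
    (\<Prod>i\<in>UNIV. primes_of i ^ lookup \<beta> i)"
  shows "\<alpha> = \<beta>"
proof (rule poly_mapping_eqI)
  fix k :: 'n
  have "multiplicity (primes_of k) (\<Prod>i\<in>UNIV. primes_of i ^ lookup \<gamma> i) = lookup \<gamma> k" for \<gamma>
  proof -
    let ?q = "inv (primes_of :: 'n \<Rightarrow> nat)"
    have "(\<Prod>i\<in>UNIV. primes_of i ^ lookup \<gamma> i) = (\<Prod>p\<in>range (primes_of :: 'n \<Rightarrow> nat). p ^ lookup \<gamma> (?q p))"
      by (subst prod.reindex) (auto simp: inj_primes_of inv_f_f[OF inj_primes_of])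
    also have "multiplicity (primes_of k) \<dots> = lookup \<gamma> (?q (primes_of k))"
      by (subst multiplicity_prod_prime_powers) (auto simp: prime_primes_of)
    finally show ?thesis
      by (simp add: inv_f_f[OF inj_primes_of])
  qed
  then show "lookup \<alpha> k = lookup \<beta> k"
    using assms by metis
qed

text \<open>At the powers of a vector of distinct primes \<open>f\<close> becomes a sum of exponentials with
  distinct bases.\<close>
lemma eval_eq_zero_imp:
  fixes f :: "'n::finite rpoly"
  assumes "\<And>x. (\<And>i. x $ i > 0) \<Longrightarrow> eval f x = 0"
  shows "f = 0"
proof -
  define L where "L \<alpha> = (\<Prod>i\<in>UNIV. real (primes_of i) ^ lookup \<alpha> i)" for \<alpha> :: "'n \<Rightarrow>\<^sub>0 nat"
  have inj: "\<alpha> = \<beta>" if "L \<alpha> = L \<beta>" for \<alpha> \<beta>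
  proof (rule prime_power_prod_inj)
    have "real (\<Prod>i\<in>UNIV. primes_of i ^ lookup \<alpha> i) = real (\<Prod>i\<in>UNIV. primes_of i ^ lookup \<beta> i)"
      using that by (simp add: L_def)
    then show "(\<Prod>i\<in>UNIV. primes_of i ^ lookup \<alpha> i) = (\<Prod>i\<in>UNIV. primes_of i ^ lookup \<beta> i)"
      by linarith
  qed
  have power: "(\<Sum>\<alpha>\<in>supp f. coeff f \<alpha> * L \<alpha> ^ k) = 0" for k
  proof -
    have "eval f (\<chi> i. real (primes_of i) ^ k) = 0"
      by (rule assms) simp
    moreover have "(\<Prod>i\<in>UNIV. (real (primes_of i) ^ k) ^ lookup \<alpha> i) = L \<alpha> ^ k" for \<alpha>
      by (simp add: L_def prod_power_distrib flip: power_mult) (simp add: mult.commute)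
    ultimately show ?thesis
      by (simp add: eval_def)
  qed
  \<comment> \<open>Linear combinations pass from the powers of \<open>L \<alpha>\<close> to an
    arbitrary polynomial in \<open>L \<alpha>\<close>, so an interpolation polynomial can isolate
    one coefficient.\<close>
  have all: "(\<Sum>\<alpha>\<in>supp f. coeff f \<alpha> * poly q (L \<alpha>)) = 0" for q
  proof -
    have "(\<Sum>\<alpha>\<in>supp f. coeff f \<alpha> * poly q (L \<alpha>)) =
        (\<Sum>k\<le>degree q. Polynomial.coeff q k * (\<Sum>\<alpha>\<in>supp f. coeff f \<alpha> * L \<alpha> ^ k))"
      by (simp add: poly_altdef sum_distrib_left mult_ac) (rule sum.swap)
    then show ?thesis
      by (simp add: power)
  qed
  have "coeff f \<alpha> = 0" for \<alpha>
  proof (rule ccontr)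
    assume nz: "coeff f \<alpha> \<noteq> 0"
    define q where "q = (\<Prod>\<beta>\<in>supp f - {\<alpha>}. [:- L \<beta>, 1:])"
    have "poly q (L \<beta>) = 0" if "\<beta> \<in> supp f - {\<alpha>}" for \<beta>
      using that by (auto simp: q_def poly_prod)
    then have "(\<Sum>\<beta>\<in>supp f. coeff f \<beta> * poly q (L \<beta>)) = coeff f \<alpha> * poly q (L \<alpha>)"
      using nz by (subst sum.remove[of _ \<alpha>]) (auto simp: in_supp_iff)
    moreover have "poly q (L \<alpha>) \<noteq> 0"
      using inj by (auto simp: q_def poly_prod)
    ultimately show False
      using all[of q] nz by simp
  qed
  then show ?thesis
    by (intro poly_mapping_eqI) (simp add: coeff_def)
qed

text \<open>Asking only for points with positive coordinates allows identities of polynomials to be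
  checked after dividing by a coordinate.\<close>

lemma eval_inject:
  assumes "\<And>x. (\<And>i. x $ i > 0) \<Longrightarrow> eval f x = eval g x"
  shows "f = g"
  using eval_eq_zero_imp[of "f - g"] assms eval_add[of f "- g"]
  by (simp add: eval_uminus)

section \<open>Homogeneity and sums of squares, tested by evaluation\<close>

definition degr :: "('n::finite \<Rightarrow>\<^sub>0 nat) \<Rightarrow> nat" where
  "degr \<alpha> = (\<Sum>i\<in>UNIV. lookup \<alpha> i)"

lemma eval_scaleR_form:
  assumes "f \<in> forms k"
  shows "eval f (c *\<^sub>R x) = c ^ k * eval f x"
proof -
  have "(\<Prod>i\<in>UNIV. (c * x $ i) ^ lookup \<alpha> i) = c ^ k * (\<Prod>i\<in>UNIV. (x $ i) ^ lookup \<alpha> i)"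
    if "\<alpha> \<in> supp f" for \<alpha>
    using that assms
    by (auto simp: power_mult_distrib prod.distrib forms_def simp flip: power_sum)
  then show ?thesis
    by (simp add: eval_def sum_distrib_left mult_ac cong: sum.cong)
qed

text \<open>The single scaling factor 2 suffices because its powers separate the degrees.
  Homogeneity of explicit products and substitutions then follows from their values, without
  computing supports.\<close>

lemma forms_iff_eval:
  "f \<in> forms k \<longleftrightarrow> (\<forall>x. eval f (2 *\<^sub>R x) = 2 ^ k * eval f x)"
proof
  assume "f \<in> forms k"
  then show "\<forall>x. eval f (2 *\<^sub>R x) = 2 ^ k * eval f x"
    by (simp add: eval_scaleR_form)
next
  assume hom: "\<forall>x. eval f (2 *\<^sub>R x) = 2 ^ k * eval f x"
  \<comment> \<open>These are the coefficients of f(2x); comparing them with those of 2^k f fixes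
    the degree of every monomial.\<close>
  define g where "g = (\<Sum>\<alpha>\<in>supp f. Poly_Mapping.single \<alpha> (coeff f \<alpha> * 2 ^ degr \<alpha>))"
  have "g = const (2 ^ k) * f"
  proof (rule eval_inject)
    fix x :: "real^'a"
    have "eval g x = eval f (2 *\<^sub>R x)"
      unfolding g_def eval_sum eval_single degr_def
      by (simp add: eval_def power_mult_distrib prod.distrib mult_ac power_sum)
    then show "eval g x = eval (const (2 ^ k) * f) x"
      using hom by (simp add: eval_mult)
  qed
  moreover have "lookup g \<alpha> = coeff f \<alpha> * 2 ^ degr \<alpha>" for \<alpha>
  proof -
    have "lookup g \<alpha> = (\<Sum>\<beta>\<in>supp f. if \<beta> = \<alpha> then coeff f \<alpha> * 2 ^ degr \<alpha> else 0)"
      unfolding g_def lookup_sum by (rule sum.cong) (auto simp: lookup_single when_def)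
    then show ?thesis
      by (auto simp: in_supp_iff)
  qed
  moreover have "lookup (const (2 ^ k) * f) \<alpha> = 2 ^ k * coeff f \<alpha>" for \<alpha>
    by (simp add: const_def coeff_def map.rep_eq when_def flip: mult_map_scale_conv_mult)
  ultimately have eq: "coeff f \<alpha> * 2 ^ degr \<alpha> = 2 ^ k * coeff f \<alpha>" for \<alpha>
    by metis
  have "degr \<alpha> = k" if "\<alpha> \<in> supp f" for \<alpha>
    using eq[of \<alpha>] that by (simp add: in_supp_iff)
  then show "f \<in> forms k"
    by (simp add: forms_def degr_def)
qed

lemma lin_subst_forms: "f \<in> forms k \<Longrightarrow> lin_subst A f \<in> forms k"
  by (simp add: forms_iff_eval eval_lin_subst matrix_vector_mult_scaleR)

lemma SOS_I:
  assumes "\<And>g. g \<in> set gs \<Longrightarrow> g \<in> forms d"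
    and "\<And>x. (\<And>i. x $ i > 0) \<Longrightarrow> eval f x = (\<Sum>g\<leftarrow>gs. eval g x ^ 2)"
  shows "f \<in> SOS (2 * d)"
proof -
  have "f = sum_list (map (\<lambda>g. g ^ 2) gs)"
    by (rule eval_inject) (simp add: assms(2) eval_sum_list eval_power o_def)
  then show ?thesis
    using assms(1) by (auto simp: SOS_def)
qed

lemma SOS_E:
  assumes "f \<in> SOS (2 * d)"
  obtains gs where "set gs \<subseteq> forms d" "f = (\<Sum>g\<leftarrow>gs. g ^ 2)"
    "\<And>x. eval f x = (\<Sum>g\<leftarrow>gs. eval g x ^ 2)"
  using assms by (auto simp: SOS_def eval_sum_list eval_power o_def)

lemma eval_SOS_nonneg: "f \<in> SOS (2 * d) \<Longrightarrow> eval f x \<ge> 0"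
  by (erule SOS_E) (auto intro!: sum_list_nonneg)

lemma lin_subst_SOS:
  assumes "f \<in> SOS (2 * d)"
  shows "lin_subst A f \<in> SOS (2 * d)"
proof -
  obtain gs where gs: "set gs \<subseteq> forms d" "\<And>x. eval f x = (\<Sum>g\<leftarrow>gs. eval g x ^ 2)"
    using SOS_E[OF assms] by metis
  show ?thesis
    by (rule SOS_I[of "map (lin_subst A) gs"])
       (use gs in \<open>auto simp: eval_lin_subst o_def intro: lin_subst_forms\<close>)
qed

lemma zero_in_SOS: "0 \<in> SOS (2 * d)"
  by (rule SOS_I[of "[]"]) auto

lemma SOS_add:
  assumes "f \<in> SOS (2 * d)" "g \<in> SOS (2 * d)"
  shows "f + g \<in> SOS (2 * d)"
proof -
  obtain fs gs where "set fs \<subseteq> forms d" "f = (\<Sum>g\<leftarrow>fs. g ^ 2)"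
    "set gs \<subseteq> forms d" "g = (\<Sum>g\<leftarrow>gs. g ^ 2)"
    using assms by (auto simp: SOS_def)
  then show ?thesis
    by (auto simp: SOS_def intro!: exI[of _ "fs @ gs"])
qed

section \<open>Nonnegative binary forms\<close>

text \<open>A nonconstant polynomial grows in absolute value at infinity, and nonnegativity removes
  the absolute value. Outside a compact interval the values are thus at least the one at 0, so a
  minimum over the interval is global.\<close>

lemma poly_attains_min:
  fixes p :: "real poly"
  assumes "\<And>x. poly p x \<ge> 0"
  shows "\<exists>a. \<forall>x. poly p a \<le> poly p x"
proof (cases "degree p = 0")
  case True
  then obtain c where "p = [:c:]"
    by (rule degree_eq_zeroE)
  then show ?thesis by simp
next
  case False
  have "\<exists>k. k \<noteq> 0 \<and> k \<le> degree p \<and> Polynomial.coeff p k \<noteq> 0"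
    using False by (intro exI[of _ "degree p"]) auto
  from polyfun_extremal[OF this, of "poly p 0"]
  have "\<forall>\<^sub>F x in at_infinity. poly p 0 \<le> \<bar>poly p x\<bar>"
    by (simp add: poly_altdef)
  then obtain R where R: "\<And>x. \<bar>x\<bar> \<ge> R \<Longrightarrow> poly p 0 \<le> poly p x"
    using assms by (auto simp: eventually_at_infinity)
  \<comment> \<open>The absolute value of \<open>R\<close> keeps 0 in the interval whatever the sign
    of \<open>R\<close>.\<close>
  have "continuous_on {-\<bar>R\<bar>..\<bar>R\<bar>} (poly p)"
    by (intro continuous_intros)
  then obtain a where a: "\<And>x. x \<in> {-\<bar>R\<bar>..\<bar>R\<bar>} \<Longrightarrow> poly p a \<le> poly p x"
    using continuous_attains_inf[of "{-\<bar>R\<bar>..\<bar>R\<bar>}" "poly p"] by fastforce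
  have "poly p a \<le> poly p x" for x
  proof (cases "x \<in> {-\<bar>R\<bar>..\<bar>R\<bar>}")
    case False
    then have "poly p 0 \<le> poly p x"
      by (intro R) auto
    then show ?thesis
      using a[of 0] by simp
  qed (rule a)
  then show ?thesis by blast
qed

lemma poly_nonneg_closure:
  fixes p :: "real poly"
  assumes "\<And>x. x \<noteq> a \<Longrightarrow> poly p x \<ge> 0"
  shows "poly p x \<ge> 0"
proof (cases "x = a")
  case True
  have "(poly p \<longlongrightarrow> poly p a) (at a)"
    using isCont_def poly_isCont by blast
  then have "poly p a \<ge> 0"
    by (rule tendsto_lowerbound) (use assms in \<open>auto simp: eventually_at_filter\<close>)
  then show ?thesis
    using True by simp
qed (rule assms)

text \<open>After one linear factor is removed, the quotient \<open>r\<close> is nonnegative to the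
  right of \<open>a\<close> and nonpositive to the left. By continuity it vanishes at
  \<open>a\<close>, which yields the second factor.\<close>

lemma nonneg_poly_root_double:
  fixes p :: "real poly"
  assumes nonneg: "\<And>x. poly p x \<ge> 0" and "poly p a = 0"
  obtains q where "p = [:-a, 1:] ^ 2 * q" "\<And>x. poly q x \<ge> 0"
proof -
  obtain r where r: "p = [:-a, 1:] * r"
    using assms(2) poly_eq_0_iff_dvd by blast
  have pos: "poly r x \<ge> 0" if "x > a" for x
    using nonneg[of x] that by (auto simp: r zero_le_mult_iff simp flip: left_diff_distrib)
  have neg: "poly r x \<le> 0" if "x < a" for x
    using nonneg[of x] that by (auto simp: r zero_le_mult_iff simp flip: left_diff_distrib)
  have lim: "(poly r \<longlongrightarrow> poly r a) (at a within A)" for A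
    using continuous_within poly_isCont continuous_at_imp_continuous_at_within by blast
  have "poly r a \<ge> 0"
    by (rule tendsto_lowerbound[OF lim[of "{a<..}"]])
       (use pos in \<open>auto simp: eventually_at_filter trivial_limit_at_right_real\<close>)
  moreover have "poly r a \<le> 0"
    by (rule tendsto_upperbound[OF lim[of "{..<a}"]])
       (use neg in \<open>auto simp: eventually_at_filter trivial_limit_at_left_real\<close>)
  ultimately obtain q where q: "r = [:-a, 1:] * q"
    using poly_eq_0_iff_dvd[of r a] by (metis dvdE order_antisym)
  have eq: "p = [:-a, 1:] ^ 2 * q"
    by (simp add: r q power2_eq_square mult.assoc del: mult_pCons_left)
  have "poly q x \<ge> 0" if "x \<noteq> a" for x
  proof -
    have "poly p x = (x - a) ^ 2 * poly q x"
      by (simp add: eq del: mult_pCons_left power2_eq_square)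
    then show ?thesis
      using nonneg[of x] that by (simp add: zero_le_mult_iff)
  qed
  then have "poly q x \<ge> 0" for x
    by (rule poly_nonneg_closure)
  with eq show ?thesis
    using that by blast
qed

text \<open>Subtracting the minimum leaves a double root, which can be split off.\<close>
lemma nonneg_poly_sum_of_squares:
  fixes p :: "real poly"
  assumes "\<And>x. poly p x \<ge> 0" "degree p \<le> 2 * d"
  shows "\<exists>qs. (\<forall>q\<in>set qs. degree q \<le> d) \<and> p = (\<Sum>q\<leftarrow>qs. q ^ 2)"
  using assms
proof (induction d arbitrary: p)
  case 0
  then obtain c where c: "p = [:c:]"
    by (auto elim: degree_eq_zeroE)
  then show ?case
    using "0.prems"(1)[of 0]
    by (intro exI[of _ "[[:sqrt c:]]"]) (simp add: power2_eq_square)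
next
  case (Suc d)
  obtain a where a: "\<And>x. poly p a \<le> poly p x"
    using poly_attains_min[OF Suc.prems(1)] by blast
  define c where "c = poly p a"
  have "c \<ge> 0"
    using Suc.prems(1) by (simp add: c_def)
  obtain q where q: "p - [:c:] = [:-a, 1:] ^ 2 * q" "\<And>x. poly q x \<ge> 0"
    by (rule nonneg_poly_root_double[of "p - [:c:]" a]) (use a in \<open>auto simp: c_def\<close>)
  have "degree q \<le> 2 * d"
  proof (cases "q = 0")
    case False
    have "degree ([:-a, 1:] ^ 2 * q) = 2 + degree q"
      using False by (simp add: degree_mult_eq degree_power_eq del: mult_pCons_left power2_eq_square)
    moreover have "degree (p - [:c:]) \<le> 2 * Suc d"
      using Suc.prems(2) by (intro degree_diff_le) auto
    ultimately show ?thesis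
      by (simp flip: q(1))
  qed simp
  then obtain qs where qs: "\<forall>q\<in>set qs. degree q \<le> d" "q = (\<Sum>q\<leftarrow>qs. q ^ 2)"
    using Suc.IH q(2) by blast
  have "p = [:c:] + [:-a, 1:] ^ 2 * q"
    using q(1) by (simp add: algebra_simps)
  also have "\<dots> = (\<Sum>r\<leftarrow>[:sqrt c:] # map (\<lambda>r. [:-a, 1:] * r) qs. r ^ 2)"
    using \<open>c \<ge> 0\<close>
    by (simp add: qs(2) o_def power_mult_distrib sum_list_const_mult del: mult_pCons_left)
       (simp add: power2_eq_square)
  finally have "p = \<dots>" .
  moreover have "degree ([:-a, 1:] * r) \<le> Suc d" if "r \<in> set qs" for r
    using degree_mult_le[of "[:-a, 1:]" r] qs(1) that by fastforce
  ultimately show ?case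
    by (intro exI[of _ "[:sqrt c:] # map (\<lambda>r. [:-a, 1:] * r) qs"]) (auto simp del: mult_pCons_left)
qed

section \<open>From univariate polynomials to binary forms\<close>

lemma prod_UNIV_two:
  fixes g :: "'n::finite \<Rightarrow> real"
  assumes "i \<noteq> j" "\<And>l. l \<noteq> i \<Longrightarrow> l \<noteq> j \<Longrightarrow> g l = 1"
  shows "(\<Prod>l\<in>UNIV. g l) = g i * g j"
proof -
  have "(\<Prod>l\<in>UNIV. g l) = (\<Prod>l\<in>{i, j}. g l)"
    by (rule prod.mono_neutral_right) (use assms in auto)
  then show ?thesis
    using assms(1) by simp
qed

lemma sum_UNIV_two:
  fixes g :: "'n::finite \<Rightarrow> nat"
  assumes "i \<noteq> j" "\<And>l. l \<noteq> i \<Longrightarrow> l \<noteq> j \<Longrightarrow> g l = 0"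
  shows "(\<Sum>l\<in>UNIV. g l) = g i + g j"
proof -
  have "(\<Sum>l\<in>UNIV. g l) = (\<Sum>l\<in>{i, j}. g l)"
    by (rule sum.mono_neutral_right) (use assms in auto)
  then show ?thesis
    using assms(1) by simp
qed

lemma poly_sum_list: "poly (sum_list ps) x = (\<Sum>p\<leftarrow>ps. poly p x)"
  by (induction ps) auto

text \<open>Setting x_j = 1 gives a nonnegative univariate \<open>p\<close> with f = x_j^(2d) p(x_i
  / x_j). Each square in a decomposition of \<open>p\<close> has a root of degree at most
  \<open>d\<close>, which \<open>G\<close> homogenizes to degree exactly \<open>d\<close>.\<close>

lemma binary_nonneg_SOS:
  fixes f :: "'n::finite rpoly"
  assumes f: "f \<in> forms (2 * d)" and "i \<noteq> j"
    and two: "\<And>\<alpha> l. \<alpha> \<in> supp f \<Longrightarrow> l \<noteq> i \<Longrightarrow> l \<noteq> j \<Longrightarrow> lookup \<alpha> l = 0"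
    and nonneg: "\<And>x. eval f x \<ge> 0"
  shows "f \<in> SOS (2 * d)"
proof -
  have deg: "lookup \<alpha> i + lookup \<alpha> j = 2 * d" if "\<alpha> \<in> supp f" for \<alpha>
    using sum_UNIV_two[OF \<open>i \<noteq> j\<close> two[OF that]] f that by (auto simp: forms_def)
  have eval: "eval f x = (\<Sum>\<alpha>\<in>supp f. coeff f \<alpha> * (x $ i ^ lookup \<alpha> i * x $ j ^ lookup \<alpha> j))" for x
    unfolding eval_def
  proof (rule sum.cong)
    fix \<alpha> assume "\<alpha> \<in> supp f"
    then show "coeff f \<alpha> * (\<Prod>l\<in>UNIV. x $ l ^ lookup \<alpha> l)
        = coeff f \<alpha> * (x $ i ^ lookup \<alpha> i * x $ j ^ lookup \<alpha> j)"
      using two prod_UNIV_two[OF \<open>i \<noteq> j\<close>, of "\<lambda>l. x $ l ^ lookup \<alpha> l"] by simp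
  qed simp
  define p where "p = (\<Sum>\<alpha>\<in>supp f. Polynomial.monom (coeff f \<alpha>) (lookup \<alpha> i))"
  have p: "poly p t = (\<Sum>\<alpha>\<in>supp f. coeff f \<alpha> * t ^ lookup \<alpha> i)" for t
    by (simp add: p_def poly_sum poly_monom)
  have "poly p t \<ge> 0" for t
    using nonneg[of "\<chi> l. if l = i then t else 1"] \<open>i \<noteq> j\<close> by (simp add: eval p)
  moreover have "degree p \<le> 2 * d"
    unfolding p_def
    by (rule degree_sum_le) (use deg in \<open>auto intro!: order.trans[OF degree_monom_le] simp flip: deg\<close>)
  ultimately obtain qs where qs: "\<And>q. q \<in> set qs \<Longrightarrow> degree q \<le> d" "p = (\<Sum>q\<leftarrow>qs. q ^ 2)"
    using nonneg_poly_sum_of_squares by blast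
  define e where "e m = Poly_Mapping.single i m + Poly_Mapping.single j (d - m)" for m
  define G :: "real poly \<Rightarrow> 'n rpoly" where "G q = (\<Sum>m\<le>d. Poly_Mapping.single (e m) (Polynomial.coeff q m))" for q
  have evalG: "eval (G q) x = (\<Sum>m\<le>d. Polynomial.coeff q m * (x $ i ^ m * x $ j ^ (d - m)))" for q x
    unfolding G_def eval_sum eval_single
    by (intro sum.cong refl arg_cong2[where f = "(*)"], subst prod_UNIV_two[OF \<open>i \<noteq> j\<close>])
       (use \<open>i \<noteq> j\<close> in \<open>auto simp: e_def lookup_add lookup_single\<close>)
  have G: "G q \<in> forms d" for q
    unfolding forms_iff_eval
    by (simp add: evalG sum_distrib_left power_mult_distrib)
       (auto intro!: sum.cong simp: mult_ac simp flip: power_add)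
  show ?thesis
  proof (rule SOS_I[of "map G qs"])
    fix x :: "real^'n" assume x: "\<And>l. x $ l > 0"
    let ?t = "x $ i / x $ j"
    have G_eq: "eval (G q) x = x $ j ^ d * poly q ?t" if "q \<in> set qs" for q
    proof -
      have "poly q ?t = (\<Sum>m\<le>d. Polynomial.coeff q m * ?t ^ m)"
        unfolding poly_altdef
        by (rule sum.mono_neutral_left) (use qs(1)[OF that] in \<open>auto intro: coeff_eq_0\<close>)
      moreover have "x $ j ^ d = x $ j ^ (d - m) * x $ j ^ m" if "m \<le> d" for m
        using that by (simp flip: power_add)
      ultimately show ?thesis
        using x[of j] by (auto simp: evalG sum_distrib_left power_divide intro!: sum.cong)
    qed
    have "eval f x = x $ j ^ (2 * d) * poly p ?t"
      using x[of j]
      by (auto simp: eval p sum_distrib_left power_divide power_add simp flip: deg intro!: sum.cong)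
    also have "\<dots> = (\<Sum>q\<leftarrow>qs. (x $ j ^ d * poly q ?t) ^ 2)"
      by (simp add: qs(2) poly_sum_list o_def power_mult_distrib sum_list_const_mult
        flip: power_mult) (simp add: mult.commute)
    also have "\<dots> = (\<Sum>g\<leftarrow>map G qs. eval g x ^ 2)"
      by (simp add: o_def G_eq cong: map_cong)
    finally show "eval f x = (\<Sum>g\<leftarrow>map G qs. eval g x ^ 2)" .
  qed (use G in auto)
qed

section \<open>Nonnegative circuits in the Hilbert cases\<close>

lemma SOS_sum: "(\<And>a. a \<in> A \<Longrightarrow> f a \<in> SOS (2 * d)) \<Longrightarrow> (\<Sum>a\<in>A. f a) \<in> SOS (2 * d)"
  by (induction A rule: infinite_finite_induct) (auto intro: zero_in_SOS SOS_add)

lemma even_monomial_SOS: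
  fixes \<alpha> :: "'n::finite \<Rightarrow>\<^sub>0 nat"
  assumes "\<And>i. even (lookup \<alpha> i)" "(\<Sum>i\<in>UNIV. lookup \<alpha> i) = 2 * d" "c \<ge> 0"
  shows "Poly_Mapping.single \<alpha> c \<in> SOS (2 * d)"
proof -
  define \<beta> where "\<beta> = Poly_Mapping.map (\<lambda>k. k div 2) \<alpha>"
  have \<beta>: "lookup \<alpha> i = lookup \<beta> i * 2" for i
    using assms(1)[of i] by (auto simp: \<beta>_def map.rep_eq when_def)
  have d: "(\<Sum>i\<in>UNIV. lookup \<beta> i) = d"
    using assms(2) by (simp add: \<beta> flip: sum_distrib_right)
  show ?thesis
  proof (rule SOS_I[of "[Poly_Mapping.single \<beta> (sqrt c)]"])
    fix g assume "g \<in> set [Poly_Mapping.single \<beta> (sqrt c)]"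
    then show "g \<in> forms d"
      using d by (auto simp: forms_def supp_def)
  qed (use assms(3) in \<open>simp add: eval_single \<beta> power_mult prod_power_distrib power_mult_distrib\<close>)
qed

lemma no_I_supp_SOS:
  assumes "f \<in> forms (2 * d)" "I_supp f = {}"
  shows "f \<in> SOS (2 * d)"
proof -
  have "(\<Sum>\<alpha>\<in>supp f. Poly_Mapping.single \<alpha> (coeff f \<alpha>)) \<in> SOS (2 * d)"
    using assms by (intro SOS_sum even_monomial_SOS) (fastforce simp: I_supp_def S_supp_def forms_def)+
  then show ?thesis
    by (simp flip: rpoly_as_sum)
qed

section \<open>Barycentric coordinates and affine relations in a circuit\<close>

lemma finite_S_supp [simp]: "finite (S_supp f)"
  by (simp add: S_supp_def)

text \<open>Affine independence makes the Newton polytope a simplex, and the relative interior of a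
  simplex consists of the points whose barycentric coordinates are all strictly positive.\<close>

lemma circuit_barycentric:
  fixes h :: "'n::finite rpoly"
  assumes "circuit h" "I_supp h = {\<beta>}"
  obtains w where "\<And>\<alpha>. \<alpha> \<in> S_supp h \<Longrightarrow> w \<alpha> > 0" "(\<Sum>\<alpha>\<in>S_supp h. w \<alpha>) = 1"
    "\<And>i. (\<Sum>\<alpha>\<in>S_supp h. w \<alpha> * real (lookup \<alpha> i)) = real (lookup \<beta> i)"
proof -
  have vert: "expvec ` S_supp h = New_vertices h" and "\<not> affine_dependent (New_vertices h)"
    and "expvec \<beta> \<in> rel_interior (New h)"
    using assms by (auto simp: circuit_def)
  moreover have "New h = convex hull (New_vertices h)"
    unfolding New_def New_vertices_def by (rule Krein_Milman_polytope) simp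
  ultimately obtain u where u: "\<And>x. x \<in> expvec ` S_supp h \<Longrightarrow> u x > 0" "sum u (expvec ` S_supp h) = 1"
    "(\<Sum>x\<in>expvec ` S_supp h. u x *\<^sub>R x) = expvec \<beta>"
    using rel_interior_convex_hull_explicit[of "New_vertices h"] by force
  have inj: "inj_on expvec (S_supp h)"
    using inj_expvec inj_on_subset by blast
  show ?thesis
  proof
    show "(\<Sum>\<alpha>\<in>S_supp h. u (expvec \<alpha>)) = 1"
      using u(2) by (simp add: sum.reindex[OF inj])
    show "(\<Sum>\<alpha>\<in>S_supp h. u (expvec \<alpha>) * real (lookup \<alpha> i)) = real (lookup \<beta> i)" for i
      using arg_cong[OF u(3), of "\<lambda>v. v $ i"] by (simp add: sum.reindex[OF inj] sum_component)
  qed (use u(1) in auto)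
qed

lemma circuit_affine_independent:
  fixes h :: "'n::finite rpoly"
  assumes "circuit h" "(\<Sum>\<alpha>\<in>S_supp h. u \<alpha>) = (0 :: real)"
    and "\<And>i. (\<Sum>\<alpha>\<in>S_supp h. u \<alpha> * real (lookup \<alpha> i)) = 0"
    and "\<alpha> \<in> S_supp h"
  shows "u \<alpha> = 0"
proof (rule ccontr)
  assume nz: "u \<alpha> \<noteq> 0"
  have inj: "inj_on expvec (S_supp h)"
    using inj_expvec inj_on_subset by blast
  have inv: "inv expvec (expvec \<beta>) = \<beta>" for \<beta> :: "'n \<Rightarrow>\<^sub>0 nat"
    by (rule inv_f_f[OF inj_expvec])
  have "affine_dependent (expvec ` S_supp h)"
    unfolding affine_dependent_explicit_finite[OF finite_imageI[OF finite_S_supp]]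
    by (rule exI[of _ "\<lambda>x. u (inv expvec x)"])
      (use assms nz in \<open>auto simp: sum.reindex[OF inj] inv vec_eq_iff sum_component o_def\<close>)
  then show False
    using assms(1) by (simp add: circuit_def)
qed

text \<open>A positively weighted sum of nonnegative numbers vanishes only if each of them does.
  Hence the variables of \<beta> are the only ones in the circuit.\<close>

lemma circuit_face:
  assumes "circuit h" "I_supp h = {\<beta>}" "lookup \<beta> l = 0" "\<alpha> \<in> supp h"
  shows "lookup \<alpha> l = 0"
proof (cases "\<alpha> \<in> S_supp h")
  case True
  obtain w where w: "\<And>\<alpha>. \<alpha> \<in> S_supp h \<Longrightarrow> w \<alpha> > 0"
    "(\<Sum>\<alpha>\<in>S_supp h. w \<alpha> * real (lookup \<alpha> l)) = real (lookup \<beta> l)"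
    using circuit_barycentric[OF assms(1,2)] by metis
  then have "\<forall>\<alpha>\<in>S_supp h. w \<alpha> * real (lookup \<alpha> l) = 0"
    using assms(3) by (subst sum_nonneg_eq_0_iff[symmetric]) (auto intro!: mult_nonneg_nonneg intro: less_imp_le)
  then show ?thesis
    using w(1) True by fastforce
next
  case False
  then show ?thesis
    using assms by (auto simp: I_supp_def)
qed

text \<open>Barycentric coordinates in a simplex are unique. If \<beta> is the midpoint of two
  vertices, all other weights are 0, while the weights of a circuit are strictly positive.\<close>

lemma circuit_midpoint:
  assumes "circuit h" "I_supp h = {\<beta>}" "p \<in> S_supp h" "q \<in> S_supp h" "p + q = \<beta> + \<beta>"
  shows "S_supp h = {p, q}"
proof -
  obtain w where w: "\<And>\<alpha>. \<alpha> \<in> S_supp h \<Longrightarrow> w \<alpha> > 0" "(\<Sum>\<alpha>\<in>S_supp h. w \<alpha>) = 1"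
    "\<And>i. (\<Sum>\<alpha>\<in>S_supp h. w \<alpha> * real (lookup \<alpha> i)) = real (lookup \<beta> i)"
    using circuit_barycentric[OF assms(1,2)] by metis
  \<comment> \<open>The difference of two barycentric representations of \<beta>: the given one and
    the midpoint.\<close>
  define u where "u \<alpha> = w \<alpha> - (if \<alpha> = p then 1/2 else 0) - (if \<alpha> = q then 1/2 else 0)" for \<alpha>
  have "u \<alpha> = 0" if "\<alpha> \<in> S_supp h" for \<alpha>
  proof (rule circuit_affine_independent[OF assms(1) _ _ that])
    show "sum u (S_supp h) = 0"
      using assms w(2) by (simp add: u_def sum_subtractf)
    fix i
    have "lookup (p + q) i = lookup (\<beta> + \<beta>) i"
      using assms(5) by simp
    then have "real (lookup p i) + real (lookup q i) = 2 * real (lookup \<beta> i)"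
      unfolding lookup_add by linarith
    then show "(\<Sum>\<alpha>\<in>S_supp h. u \<alpha> * real (lookup \<alpha> i)) = 0"
      using assms w(3)[of i]
      by (simp add: u_def sum_subtractf left_diff_distrib if_distrib[of "\<lambda>x. x * _"] cong: if_cong)
  qed
  then have "\<alpha> \<in> {p, q}" if "\<alpha> \<in> S_supp h" for \<alpha>
    using w(1)[OF that] that by (fastforce simp: u_def split: if_splits)
  then show ?thesis
    using assms by blast
qed

text \<open>The weights 1, 1, -2 at \<open>p\<close>, \<open>q\<close>, \<open>r\<close> would form
  an affine relation among vertices that are affinely independent.\<close>

lemma circuit_no_midpoint:
  assumes "circuit h" "p \<in> S_supp h" "q \<in> S_supp h" "r \<in> S_supp h" "p + q = r + r"
    "p \<noteq> r" "q \<noteq> r"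
  shows False
proof -
  define u :: "_ \<Rightarrow> real"
    where "u \<alpha> = (if \<alpha> = p then 1 else 0) + (if \<alpha> = q then 1 else 0) - (if \<alpha> = r then 2 else 0)" for \<alpha>
  have "u r = 0"
  proof (rule circuit_affine_independent[OF assms(1) _ _ assms(4)])
    show "sum u (S_supp h) = 0"
      using assms by (simp add: u_def sum_subtractf sum.distrib)
    fix i
    have "lookup (p + q) i = lookup (r + r) i"
      using assms(5) by simp
    then have "real (lookup p i) + real (lookup q i) = 2 * real (lookup r i)"
      unfolding lookup_add by linarith
    then show "(\<Sum>\<alpha>\<in>S_supp h. u \<alpha> * real (lookup \<alpha> i)) = 0"
      using assms
      by (simp add: u_def sum_subtractf sum.distrib distrib_right left_diff_distrib
          if_distrib[of "\<lambda>x. x * _"] cong: if_cong)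
  qed
  then show False
    using assms by (simp add: u_def)
qed

lemma psd_binary_quadratic:
  fixes a b c :: real
  assumes "\<And>X Y. a * X ^ 2 + b * X * Y + c * Y ^ 2 \<ge> 0"
  shows "\<exists>p q r. \<forall>X Y. a * X ^ 2 + b * X * Y + c * Y ^ 2 = (p * X + q * Y) ^ 2 + (r * Y) ^ 2"
proof -
  have "a \<ge> 0" "c \<ge> 0"
    using assms[of 1 0] assms[of 0 1] by auto
  show ?thesis
  proof (cases "a = 0")
    case True
    \<comment> \<open>At Y = 1 and X = -(c + 1)/b the form with a = 0 would take the value
      -1.\<close>
    have "b = 0"
      using assms[of "- (c + 1) / b" 1] True by (cases "b = 0") auto
    with True \<open>c \<ge> 0\<close> show ?thesis
      by (intro exI[of _ 0] exI[of _ "sqrt c"]) (simp add: power_mult_distrib)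
  next
    case False
    with \<open>a \<ge> 0\<close> have "a > 0" by simp
    \<comment> \<open>The test point minimizes the form over X at Y = 1; its value there is the
      remainder after completing the square.\<close>
    have "c - b\<^sup>2 / (4 * a) \<ge> 0"
      using assms[of "- b / (2 * a)" 1] \<open>a > 0\<close> by (simp add: field_simps power2_eq_square)
    then have "a * X ^ 2 + b * X * Y + c * Y ^ 2 =
        (sqrt a * X + b / (2 * sqrt a) * Y) ^ 2 + (sqrt (c - b\<^sup>2 / (4 * a)) * Y) ^ 2" for X Y
      using \<open>a > 0\<close>
      by (simp add: power_mult_distrib power2_sum power_divide)
         (simp add: algebra_simps)
    then show ?thesis by blast
  qed
qed

section \<open>Quartic circuits with interior exponent (2,1,1)\<close>

lemmas eval_simps = eval_add eval_mult eval_power eval_const eval_var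

text \<open>The identity U y^4 + U t^8 z^4 = U (y^2 - t^4 z^2)^2 + 2 U t^4 (y z)^2 splits off a
  square. An eighth root is taken because the points where this square vanishes are then y = t s, z
  = s/t up to signs, with no further roots of the coefficients.\<close>

lemma eighth_root_scaling:
  assumes "A > (0::real)" "U > 0"
  obtains t where "t > 0" "A = U * t ^ 8"
  using assms by (intro that[of "root 8 (A / U)"]) auto

text \<open>The digits in the following names are the exponents of the vertices of the Newton polytope;
  the interior exponent is always \<open>(2,1,1)\<close>.\<close>

context
  fixes i j k :: "'n::finite" and h :: "'n rpoly"
  assumes h: "\<And>x. eval h x \<ge> 0"
begin

text \<open>The factor (x_i)^2 splits off and leaves a binary quadratic form in x_j and x_k, whose
  nonnegativity is seen at x_i = 1.\<close>

lemma quartic_220_202_SOS: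
  assumes ij: "i \<noteq> j" "i \<noteq> k" 
    and eq: "\<And>x. eval h x = P * (x$i)^2 * (x$j)^2 + R * (x$i)^2 * (x$k)^2 + b * (x$i)^2 * x$j * x$k"
    and "j \<noteq> k"
  shows "h \<in> SOS (2 * 2)"
proof -
  have "P * X ^ 2 + b * X * Y + R * Y ^ 2 \<ge> 0" for X Y
    using h[of "\<chi> l. if l = i then 1 else if l = j then X else Y"] assms by (simp add: eq)
  then obtain p q r where pqr: "\<And>X Y. P * X ^ 2 + b * X * Y + R * Y ^ 2 = (p * X + q * Y) ^ 2 + (r * Y) ^ 2"
    using psd_binary_quadratic by metis
  show ?thesis
  proof (rule SOS_I[of "[var i * (const p * var j + const q * var k), var i * (const r * var k)]"])
    fix x :: "real^'n"
    have "eval h x = (x$i)^2 * (P * (x$j)^2 + b * x$j * x$k + R * (x$k)^2)"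
      by (simp add: eq algebra_simps)
    then show "eval h x = (\<Sum>g\<leftarrow>[var i * (const p * var j + const q * var k), var i * (const r * var k)]. eval g x ^ 2)"
      by (simp add: pqr eval_simps power_mult_distrib distrib_left[of "(x$i)^2"])
  qed (auto simp: forms_iff_eval eval_simps algebra_simps)
qed

text \<open>This is a quadratic form in X = (x_i)^2 and Y = x_j x_k. Real points reach only X >= 0,
  but the form is unchanged under (X, Y) -> (-X, -Y), which covers the other half plane.\<close>

lemma quartic_400_022_SOS:
  assumes ij: "i \<noteq> j" "i \<noteq> k" "j \<noteq> k"
    and eq: "\<And>x. eval h x = A * (x$i)^4 + V * (x$j)^2 * (x$k)^2 + b * (x$i)^2 * x$j * x$k"
  shows "h \<in> SOS (2 * 2)"
proof -
  have *: "A * X ^ 2 + b * X * Y + V * Y ^ 2 \<ge> 0" if "X \<ge> 0" for X Y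
    using h[of "\<chi> l. if l = i then sqrt X else if l = j then Y else 1"] ij that
      power_mult[of "sqrt X" 2 2]
    by (simp add: eq algebra_simps)
  have "A * X ^ 2 + b * X * Y + V * Y ^ 2 \<ge> 0" for X Y
    using *[of X Y] *[of "-X" "-Y"] by (cases "X \<ge> 0") auto
  then obtain p q r where pqr: "\<And>X Y. A * X ^ 2 + b * X * Y + V * Y ^ 2 = (p * X + q * Y) ^ 2 + (r * Y) ^ 2"
    using psd_binary_quadratic by metis
  let ?gs = "[const p * var i ^ 2 + const q * (var j * var k), const r * (var j * var k)]"
  show ?thesis
  proof (rule SOS_I[of ?gs])
    fix x :: "real^'n"
    have "eval h x = A * ((x$i)^2) ^ 2 + b * (x$i)^2 * (x$j * x$k) + V * (x$j * x$k)^2"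
      by (simp add: eq algebra_simps flip: power_mult)
    then show "eval h x = (\<Sum>g\<leftarrow>?gs. eval g x ^ 2)"
      unfolding pqr by (simp add: eval_simps)
  qed (auto simp: forms_iff_eval eval_simps algebra_simps)
qed

text \<open>Subtracting U ((x_j)^2 - t^4 (x_k)^2)^2 leaves a quadratic form in (x_i)^2 and x_j x_k.
  It agrees with \<open>h\<close> where the subtracted square vanishes, and such points already
  realize every value of x_j x_k.\<close>

lemma quartic_400_040_004_SOS:
  assumes ij: "i \<noteq> j" "i \<noteq> k" "j \<noteq> k"
    and eq: "\<And>x. eval h x = A * (x$i)^4 + U * (x$j)^4 + W * (x$k)^4 + b * (x$i)^2 * x$j * x$k"
    and pos: "U > 0" "W > 0"
  shows "h \<in> SOS (2 * 2)"
proof -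
  obtain t where t: "t > 0" "W = U * t ^ 8"
    using eighth_root_scaling[OF pos(2,1)] .
  have gen: "0 \<le> A * s ^ 4 + U * y ^ 4 + W * z ^ 4 + b * s ^ 2 * y * z" for s y z
    using h[of "\<chi> l. if l = i then s else if l = j then y else z"] ij by (simp add: eq)
  have *: "A * X ^ 2 + b * X * Y + (2 * U * t ^ 4) * Y ^ 2 \<ge> 0" if "X \<ge> 0" for X Y
  proof -
    \<comment> \<open>The point with y z = Y on which y^2 = t^4 z^2, so that the split-off square is
      0.\<close>
    define y z where "y = t * sqrt \<bar>Y\<bar>" and "z = sgn Y * sqrt \<bar>Y\<bar> / t"
    have "y * z = sgn Y * (sqrt \<bar>Y\<bar> * sqrt \<bar>Y\<bar>)"
      using t(1) by (simp add: y_def z_def del: real_sqrt_mult_self)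
    then have yz: "y * z = Y"
      by (simp add: sgn_mult_abs)
    have root: "sqrt \<bar>Y\<bar> ^ 4 = Y ^ 2"
      using power_mult[of "sqrt \<bar>Y\<bar>" 2 2] by simp
    then have y4: "y ^ 4 = t ^ 4 * Y ^ 2"
      by (simp add: y_def power_mult_distrib)
    have "sgn Y ^ 4 * Y ^ 2 = Y ^ 2"
      by (simp add: sgn_if)
    then have "t ^ 4 * z ^ 4 = Y ^ 2"
      using root t(1) by (simp add: z_def power_mult_distrib power_divide)
    moreover have "t ^ 8 = t ^ 4 * t ^ 4"
      by (simp flip: power_add)
    ultimately have z4: "W * z ^ 4 = U * t ^ 4 * Y ^ 2"
      by (simp only: t(2) mult.assoc)
    have "sqrt X ^ 4 = X ^ 2"
      using that power_mult[of "sqrt X" 2 2] by simp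
    then have "0 \<le> A * X ^ 2 + U * y ^ 4 + W * z ^ 4 + b * X * (y * z)"
      using gen[of "sqrt X" y z] that by (simp add: mult.assoc)
    then show ?thesis
      by (simp add: yz y4 z4 algebra_simps)
  qed
  have "A * X ^ 2 + b * X * Y + (2 * U * t ^ 4) * Y ^ 2 \<ge> 0" for X Y
    using *[of X Y] *[of "-X" "-Y"] by (cases "X \<ge> 0") auto
  then obtain p q r where pqr: "\<And>X Y. A * X ^ 2 + b * X * Y + (2 * U * t ^ 4) * Y ^ 2 = (p * X + q * Y) ^ 2 + (r * Y) ^ 2"
    using psd_binary_quadratic by metis
  let ?gs = "[const p * var i ^ 2 + const q * (var j * var k), const r * (var j * var k),
    const (sqrt U) * (var j ^ 2 + const (- (t ^ 4)) * var k ^ 2)]"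
  show ?thesis
  proof (rule SOS_I[of ?gs])
    fix x :: "real^'n"
    have "eval h x = A * ((x$i)^2) ^ 2 + b * (x$i)^2 * (x$j * x$k) + (2 * U * t ^ 4) * (x$j * x$k)^2
        + U * ((x$j)^2 - t ^ 4 * (x$k)^2)^2"
      by (simp add: eq t(2) power2_diff power_mult_distrib algebra_simps flip: power_mult)
    then show "eval h x = (\<Sum>g\<leftarrow>?gs. eval g x ^ 2)"
      unfolding pqr using pos by (simp add: eval_simps power_mult_distrib)
  qed (auto simp: forms_iff_eval eval_simps algebra_simps)
qed

text \<open>Subtracting U ((x_j)^2 - t^4 (x_i)^2)^2 leaves (x_i)^2 times a quadratic form in x_j and
  x_k; again \<open>h\<close> is evaluated where the subtracted square vanishes.\<close>

lemma quartic_400_040_202_SOS: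
  assumes ij: "i \<noteq> j" "i \<noteq> k" "j \<noteq> k"
    and eq: "\<And>x. eval h x = A * (x$i)^4 + U * (x$j)^4 + R * (x$i)^2 * (x$k)^2 + b * (x$i)^2 * x$j * x$k"
    and pos: "A > 0" "U > 0" "R \<ge> 0"
  shows "h \<in> SOS (2 * 2)"
proof -
  obtain t where t: "t > 0" "A = U * t ^ 8"
    using eighth_root_scaling[OF pos(1,2)] .
  have "(2 * U * t ^ 4) * X ^ 2 + b * X * Y + R * Y ^ 2 \<ge> 0" for X Y
  proof (cases "X = 0")
    case False
    \<comment> \<open>With x_i = X/t^2 and x_j = X the square vanishes and \<open>h\<close> is
      (x_i)^2 times the quadratic form. At X = 0 this factor is lost, and R >= 0 takes over.\<close>
    let ?x = "X / t ^ 2"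
    have *: "eval h (\<chi> l. if l = i then ?x else if l = j then X else Y) =
        ?x ^ 2 * ((2 * U * t ^ 4) * X ^ 2 + b * X * Y + R * Y ^ 2)"
      using ij t by (simp add: eq power_divide field_simps flip: power_mult power_add)
    have "?x ^ 2 > 0"
      using False t(1) by simp
    then show ?thesis
      using h[of "\<chi> l. if l = i then ?x else if l = j then X else Y"] unfolding *
      by (simp add: zero_le_mult_iff)
  qed (use pos in simp)
  then obtain p q r where pqr: "\<And>X Y. (2 * U * t ^ 4) * X ^ 2 + b * X * Y + R * Y ^ 2 = (p * X + q * Y) ^ 2 + (r * Y) ^ 2"
    using psd_binary_quadratic by metis
  let ?gs = "[var i * (const p * var j + const q * var k), var i * (const r * var k),
    const (sqrt U) * (var j ^ 2 + const (- (t ^ 4)) * var i ^ 2)]"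
  show ?thesis
  proof (rule SOS_I[of ?gs])
    fix x :: "real^'n"
    have "eval h x = (x$i)^2 * ((2 * U * t ^ 4) * (x$j)^2 + b * x$j * x$k + R * (x$k)^2)
        + U * ((x$j)^2 - t ^ 4 * (x$i)^2)^2"
      by (simp add: eq t(2) power2_diff power_mult_distrib algebra_simps flip: power_mult)
    then show "eval h x = (\<Sum>g\<leftarrow>?gs. eval g x ^ 2)"
      unfolding pqr using pos by (simp add: eval_simps power_mult_distrib distrib_left[of "(x$i)^2"])
  qed (auto simp: forms_iff_eval eval_simps algebra_simps)
qed

end

section \<open>The possible Newton polytopes of a ternary quartic circuit\<close>

definition mono3 :: "'n \<Rightarrow> 'n \<Rightarrow> 'n \<Rightarrow> nat \<Rightarrow> nat \<Rightarrow> nat \<Rightarrow> ('n \<Rightarrow>\<^sub>0 nat)" where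
  "mono3 i j k a b c = Poly_Mapping.single i a + Poly_Mapping.single j b + Poly_Mapping.single k c"

lemma lookup_mono3:
  "lookup (mono3 i j k a b c) l =
    (if l = i then a else 0) + (if l = j then b else 0) + (if l = k then c else 0)"
  by (simp add: mono3_def lookup_add lookup_single when_def)

lemma mono3_add: "mono3 i j k a b c + mono3 i j k a' b' c' = mono3 i j k (a + a') (b + b') (c + c')"
  by (rule poly_mapping_eqI) (simp add: lookup_mono3 lookup_add)

lemma mono3_inject:
  assumes "i \<noteq> j" "i \<noteq> k" "j \<noteq> k"
  shows "mono3 i j k a b c = mono3 i j k a' b' c' \<longleftrightarrow> a = a' \<and> b = b' \<and> c = c'"
  using assms by (auto simp: poly_mapping_eq_iff fun_eq_iff lookup_mono3)

lemma prod_UNIV_three: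
  fixes g :: "'n::finite \<Rightarrow> real"
  assumes "i \<noteq> j" "i \<noteq> k" "j \<noteq> k" "\<And>l. l \<notin> {i, j, k} \<Longrightarrow> g l = 1"
  shows "(\<Prod>l\<in>UNIV. g l) = g i * g j * g k"
proof -
  have "(\<Prod>l\<in>UNIV. g l) = (\<Prod>l\<in>{i, j, k}. g l)"
    by (rule prod.mono_neutral_right) (use assms in auto)
  then show ?thesis
    using assms by (simp add: mult.assoc)
qed

lemma sum_UNIV_three:
  fixes g :: "'n::finite \<Rightarrow> nat"
  assumes "i \<noteq> j" "i \<noteq> k" "j \<noteq> k" "\<And>l. l \<notin> {i, j, k} \<Longrightarrow> g l = 0"
  shows "(\<Sum>l\<in>UNIV. g l) = g i + g j + g k"
proof -
  have "(\<Sum>l\<in>UNIV. g l) = (\<Sum>l\<in>{i, j, k}. g l)"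
    by (rule sum.mono_neutral_right) (use assms in auto)
  then show ?thesis
    using assms by (simp add: add.assoc)
qed

lemma eval_single_mono3:
  fixes i :: "'n::finite"
  assumes "i \<noteq> j" "i \<noteq> k" "j \<noteq> k"
  shows "eval (Poly_Mapping.single (mono3 i j k a b c) r) x = r * (x$i ^ a * x$j ^ b * x$k ^ c)"
  unfolding eval_single
  by (subst prod_UNIV_three[OF assms]) (use assms in \<open>auto simp: lookup_mono3\<close>)

lemma circuit_coeff:
  assumes "I_supp h = {\<beta>}"
  shows "\<And>\<alpha>. \<alpha> \<in> S_supp h \<Longrightarrow> coeff h \<alpha> > 0" "\<beta> \<notin> S_supp h" "supp h = insert \<beta> (S_supp h)"
  using assms by (auto simp: I_supp_def S_supp_def)

lemma even_sum_four_cases: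
  fixes a b c :: nat
  assumes "even a" "even b" "even c" "a + b + c = 4"
  shows "(a, b, c) \<in> {(4,0,0), (0,4,0), (0,0,4), (2,2,0), (2,0,2), (0,2,2)}"
proof -
  obtain a' b' c' where *: "a = 2 * a'" "b = 2 * b'" "c = 2 * c'"
    using assms(1-3) by (auto elim!: evenE)
  then have "a' + b' + c' = 2"
    using assms(4) by simp
  then have "(a', b', c') \<in> {(2,0,0), (0,2,0), (0,0,2), (1,1,0), (1,0,1), (0,1,1)}"
    by (simp, presburger)
  then show ?thesis
    using * by auto
qed

text \<open>The exponent (2,1,1) is the midpoint of 220 and 202 and also of 400 and 022, so either
  pair, once present, is the whole vertex set. Otherwise 400 is a vertex and 022 is not. Since 220
  is the midpoint of 400 and 040, exactly one of these last two occurs with 400; likewise for 202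
  and 004. Excluding 220 together with 202 leaves three triangles.\<close>

lemma ternary_quartic_circuit_SOS:
  fixes h :: "'n::finite rpoly"
  assumes ij: "i \<noteq> j" "i \<noteq> k" "j \<noteq> k" and UNIV: "UNIV = {i, j, k}"
    and form: "h \<in> forms 4" and circ: "circuit h" and nonneg: "\<And>x. eval h x \<ge> 0"
    and I: "I_supp h = {mono3 i j k 2 1 1}"
  shows "h \<in> SOS (2 * 2)"
proof -
  let ?m = "mono3 i j k"
  let ?S = "S_supp h"
  let ?T = "{?m 4 0 0, ?m 0 4 0, ?m 0 0 4, ?m 2 2 0, ?m 2 0 2, ?m 0 2 2}"
  note inject = mono3_inject[OF ij]
  have mono: "\<alpha> = ?m (lookup \<alpha> i) (lookup \<alpha> j) (lookup \<alpha> k)" for \<alpha> :: "'n \<Rightarrow>\<^sub>0 nat"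
  proof (rule poly_mapping_eqI)
    fix l :: 'n
    have "l \<in> {i, j, k}"
      using UNIV by blast
    then show "lookup \<alpha> l = lookup (?m (lookup \<alpha> i) (lookup \<alpha> j) (lookup \<alpha> k)) l"
      using ij by (auto simp: lookup_mono3)
  qed
  have S_sub: "?S \<subseteq> ?T"
  proof
    fix \<alpha> assume \<alpha>: "\<alpha> \<in> ?S"
    have "lookup \<alpha> i + lookup \<alpha> j + lookup \<alpha> k = 4"
    proof -
      have "(\<Sum>l\<in>UNIV. lookup \<alpha> l) = 4"
        using \<alpha> form by (auto simp: S_supp_def forms_def)
      then show ?thesis
        using sum_UNIV_three[OF ij, of "lookup \<alpha>"] UNIV by auto
    qed
    moreover have "even (lookup \<alpha> l)" for l
      using \<alpha> by (auto simp: S_supp_def)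
    ultimately have "(lookup \<alpha> i, lookup \<alpha> j, lookup \<alpha> k)
        \<in> {(4,0,0), (0,4,0), (0,0,4), (2,2,0), (2,0,2), (0,2,2)}"
      by (intro even_sum_four_cases)
    then have "?m (lookup \<alpha> i) (lookup \<alpha> j) (lookup \<alpha> k) \<in> ?T"
      by (elim insertE emptyE) simp_all
    then show "\<alpha> \<in> ?T"
      by (simp flip: mono)
  qed
  have sum_T: "(\<Sum>\<alpha>\<in>?S. g \<alpha>) = (\<Sum>\<alpha>\<in>?T. if \<alpha> \<in> ?S then g \<alpha> else 0)" for g :: "_ \<Rightarrow> real"
    using S_sub by (intro sum.mono_neutral_cong_left) auto
  \<comment> \<open>Extending the coefficients by 0 to all six even exponents gives one formula for
    \<open>h\<close> that serves every case.\<close>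
  define c where "c \<alpha> = (if \<alpha> \<in> ?S then coeff h \<alpha> else 0)" for \<alpha>
  define b where "b = coeff h (?m 2 1 1)"
  have c_pos: "\<alpha> \<in> ?S \<Longrightarrow> c \<alpha> > 0" and c_zero: "\<alpha> \<notin> ?S \<Longrightarrow> c \<alpha> = 0" for \<alpha>
    using circuit_coeff(1)[OF I] by (auto simp: c_def)
  have c_nonneg: "c \<alpha> \<ge> 0" for \<alpha>
    using c_pos c_zero by (cases "\<alpha> \<in> ?S") (auto intro: less_imp_le)
  have eval: "eval h x = c (?m 4 0 0) * (x$i)^4 + c (?m 0 4 0) * (x$j)^4 + c (?m 0 0 4) * (x$k)^4
      + c (?m 2 2 0) * (x$i)^2 * (x$j)^2 + c (?m 2 0 2) * (x$i)^2 * (x$k)^2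
      + c (?m 0 2 2) * (x$j)^2 * (x$k)^2 + b * (x$i)^2 * x$j * x$k" for x
  proof -
    let ?e = "\<lambda>\<alpha>. eval (Poly_Mapping.single \<alpha> (coeff h \<alpha>)) x"
    have "eval h x = ?e (?m 2 1 1) + (\<Sum>\<alpha>\<in>?S. ?e \<alpha>)"
      using circuit_coeff(2)[OF I]
      by (subst rpoly_as_sum) (simp add: eval_sum eval_add circuit_coeff(3)[OF I])
    also have "(\<Sum>\<alpha>\<in>?S. ?e \<alpha>) = (\<Sum>\<alpha>\<in>?T. eval (Poly_Mapping.single \<alpha> (c \<alpha>)) x)"
      unfolding sum_T c_def by (intro sum.cong) (auto simp: eval_single)
    finally show ?thesis
      by (simp add: inject eval_single_mono3[OF ij] b_def)
  qed
  obtain w where w: "\<And>\<alpha>. \<alpha> \<in> ?S \<Longrightarrow> w \<alpha> > 0" "(\<Sum>\<alpha>\<in>?S. w \<alpha>) = 1"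
    "\<And>l. (\<Sum>\<alpha>\<in>?S. w \<alpha> * real (lookup \<alpha> l)) = real (lookup (?m 2 1 1) l)"
    using circuit_barycentric[OF circ I] by metis
  define L where "L \<alpha> = (if \<alpha> \<in> ?S then w \<alpha> else 0)" for \<alpha>
  have L_pos: "\<alpha> \<in> ?S \<longleftrightarrow> L \<alpha> > 0" and L_nonneg: "L \<alpha> \<ge> 0" for \<alpha>
    using w(1) by (auto simp: L_def intro: less_imp_le)
  have sum_L: "(\<Sum>\<alpha>\<in>?T. L \<alpha> * real (lookup \<alpha> l)) = real (lookup (?m 2 1 1) l)" for l
    unfolding w(3)[symmetric] sum_T L_def by (intro sum.cong) auto
  have Li: "4 * L (?m 4 0 0) + 2 * L (?m 2 2 0) + 2 * L (?m 2 0 2) = 2"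
    using sum_L[of i] ij by (simp add: inject lookup_mono3)
  have Lj: "4 * L (?m 0 4 0) + 2 * L (?m 2 2 0) + 2 * L (?m 0 2 2) = 1"
    using sum_L[of j] ij by (simp add: inject lookup_mono3)
  have Lk: "4 * L (?m 0 0 4) + 2 * L (?m 2 0 2) + 2 * L (?m 0 2 2) = 1"
    using sum_L[of k] ij by (simp add: inject lookup_mono3)
  consider "?m 2 2 0 \<in> ?S" "?m 2 0 2 \<in> ?S" | "?m 4 0 0 \<in> ?S" "?m 0 2 2 \<in> ?S"
    | "?m 2 2 0 \<notin> ?S \<or> ?m 2 0 2 \<notin> ?S" "?m 4 0 0 \<notin> ?S \<or> ?m 0 2 2 \<notin> ?S" by blast
  then show ?thesis
  proof cases
    case 1
    then have "?S = {?m 2 2 0, ?m 2 0 2}"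
      by (rule circuit_midpoint[OF circ I]) (simp add: mono3_add inject)
    then show ?thesis
      using quartic_220_202_SOS[OF nonneg ij(1,2) _ ij(3), of "c (?m 2 2 0)" "c (?m 2 0 2)" b]
      by (simp add: eval c_zero inject)
  next
    case 2
    then have "?S = {?m 4 0 0, ?m 0 2 2}"
      by (rule circuit_midpoint[OF circ I]) (simp add: mono3_add inject)
    then show ?thesis
      using quartic_400_022_SOS[OF nonneg ij, of "c (?m 4 0 0)" "c (?m 0 2 2)" b]
      by (simp add: eval c_zero inject)
  next
    case 3
    \<comment> \<open>If the weight at 400 were 0, the three coordinate equations would put weight
      1/2 on each of 220 and 202, a pair that is excluded here.\<close>
    have "?m 4 0 0 \<in> ?S"
      using 3(1) Li Lj Lk L_nonneg[of "?m 0 4 0"] L_nonneg[of "?m 0 0 4"] L_nonneg[of "?m 0 2 2"]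
        L_nonneg[of "?m 2 2 0"] L_nonneg[of "?m 2 0 2"] L_nonneg[of "?m 4 0 0"]
      unfolding L_pos by linarith
    with 3(2) have n022: "?m 0 2 2 \<notin> ?S"
      by blast
    have "?m 2 2 0 \<notin> ?S \<or> ?m 0 4 0 \<notin> ?S"
      using circuit_no_midpoint[OF circ \<open>?m 4 0 0 \<in> ?S\<close>, of "?m 0 4 0" "?m 2 2 0"]
      by (auto simp: mono3_add inject)
    moreover have "?m 2 0 2 \<notin> ?S \<or> ?m 0 0 4 \<notin> ?S"
      using circuit_no_midpoint[OF circ \<open>?m 4 0 0 \<in> ?S\<close>, of "?m 0 0 4" "?m 2 0 2"]
      by (auto simp: mono3_add inject)
    moreover have "?m 0 4 0 \<in> ?S \<or> ?m 2 2 0 \<in> ?S" "?m 0 0 4 \<in> ?S \<or> ?m 2 0 2 \<in> ?S"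
      using n022 Lj Lk L_nonneg[of "?m 0 4 0"] L_nonneg[of "?m 0 0 4"] L_nonneg[of "?m 0 2 2"]
        L_nonneg[of "?m 2 2 0"] L_nonneg[of "?m 2 0 2"]
      unfolding L_pos by linarith+
    ultimately consider
        "?m 0 4 0 \<in> ?S" "?m 0 0 4 \<in> ?S" "?m 2 2 0 \<notin> ?S" "?m 2 0 2 \<notin> ?S"
      | "?m 0 4 0 \<in> ?S" "?m 2 0 2 \<in> ?S" "?m 2 2 0 \<notin> ?S" "?m 0 0 4 \<notin> ?S"
      | "?m 0 0 4 \<in> ?S" "?m 2 2 0 \<in> ?S" "?m 2 0 2 \<notin> ?S" "?m 0 4 0 \<notin> ?S"
      using 3(1) by blast
    then show ?thesis
    proof cases
      case 1
      show ?thesis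
        by (rule quartic_400_040_004_SOS[OF nonneg ij, of "c (?m 4 0 0)" "c (?m 0 4 0)" "c (?m 0 0 4)" b])
           (use 1 n022 c_pos in \<open>auto simp: eval c_zero\<close>)
    next
      case 2
      show ?thesis
        by (rule quartic_400_040_202_SOS[OF nonneg ij, of "c (?m 4 0 0)" "c (?m 0 4 0)" "c (?m 2 0 2)" b])
           (use 2 n022 c_pos c_nonneg \<open>?m 4 0 0 \<in> ?S\<close> in \<open>auto simp: eval c_zero\<close>)
    next
      \<comment> \<open>The mirror image of the preceding case under exchanging \<open>j\<close> and
        \<open>k\<close>.\<close>
      case 3
      show ?thesis
        by (rule quartic_400_040_202_SOS[OF nonneg ij(2,1) ij(3)[symmetric],
              of "c (?m 4 0 0)" "c (?m 0 0 4)" "c (?m 2 2 0)" b])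
           (use 3 n022 c_pos c_nonneg \<open>?m 4 0 0 \<in> ?S\<close> in \<open>auto simp: eval c_zero\<close>)
    qed
  qed
qed

text \<open>At the unit vector of the variable \<open>i\<close> only the pure power survives, so its
  coefficient is a value of \<open>f\<close>. This prevents the interior exponent of a circuit from
  involving a single variable.\<close>

lemma nonneg_form_pure_power:
  fixes f :: "'n::finite rpoly"
  assumes "f \<in> forms k" "\<And>x. eval f x \<ge> 0" "\<beta> \<in> supp f" "\<And>l. l \<noteq> i \<Longrightarrow> lookup \<beta> l = 0" "even k"
  shows "\<beta> \<in> S_supp f"
proof -
  have deg: "(\<Sum>l\<in>UNIV. lookup \<alpha> l) = k" if "\<alpha> \<in> supp f" for \<alpha>
    using assms(1) that by (auto simp: forms_def)
  have sum_i: "(\<Sum>l\<in>UNIV. lookup \<alpha> l) = lookup \<alpha> i + (\<Sum>l\<in>UNIV - {i}. lookup \<alpha> l)" for \<alpha> :: "'n \<Rightarrow>\<^sub>0 nat"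
    by (rule sum.remove) auto
  have \<beta>: "lookup \<beta> i = k"
    using deg[OF assms(3)] sum_i[of \<beta>] assms(4) by simp
  have "(\<Prod>l\<in>UNIV. axis i 1 $ l ^ lookup \<alpha> l) = (if \<alpha> = \<beta> then 1 else (0 :: real))"
    if \<alpha>: "\<alpha> \<in> supp f" for \<alpha>
  proof (cases "\<alpha> = \<beta>")
    case True
    then show ?thesis
      using assms(4) by (auto simp: axis_def intro!: prod.neutral)
  next
    case False
    have "\<exists>l. l \<noteq> i \<and> lookup \<alpha> l \<noteq> 0"
    proof (rule ccontr)
      assume *: "\<not> (\<exists>l. l \<noteq> i \<and> lookup \<alpha> l \<noteq> 0)"
      then have "(\<Sum>l\<in>UNIV - {i}. lookup \<alpha> l) = 0"
        by (intro sum.neutral) auto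
      then have "lookup \<alpha> i = k"
        using deg[OF \<alpha>] sum_i[of \<alpha>] by linarith
      then have "\<alpha> = \<beta>"
        using * \<beta> assms(4) by (intro poly_mapping_eqI) metis
      then show False
        using False by blast
    qed
    then show ?thesis
      using False by (auto simp: axis_def)
  qed
  then have "eval f (axis i 1) = coeff f \<beta>"
    using assms(3) by (simp add: eval_def if_distrib[of "(*) _"] cong: sum.cong if_cong)
  then have "coeff f \<beta> > 0"
    using assms(2)[of "axis i 1"] assms(3) by (simp add: in_supp_iff)
  moreover have "even (lookup \<beta> l)" for l
    using \<beta> assms(4,5) by (cases "l = i") auto
  ultimately show ?thesis
    using assms(3) by (auto simp: S_supp_def)
qed

lemma nonneg_circuit_SOS:
  fixes h :: "'n::finite rpoly"
  assumes form: "h \<in> forms (2 * d)" and h: "nonneg_circuit h"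
    and cases: "hilbert_case CARD('n) (2 * d) \<or> CARD('n) = 1"
  shows "h \<in> SOS (2 * d)"
proof (cases "I_supp h = {}")
  case True
  then show ?thesis
    using no_I_supp_SOS[OF form] by blast
next
  case False
  have circ: "circuit h" and nonneg: "eval h x \<ge> 0" for x
    using h by (auto simp: nonneg_circuit_def)
  obtain \<beta> where I: "I_supp h = {\<beta>}"
    using circ False by (auto simp: circuit_def)
  then have \<beta>: "\<beta> \<in> supp h" "\<beta> \<notin> S_supp h"
    by (auto simp: I_supp_def)
  have deg: "(\<Sum>l\<in>UNIV. lookup \<beta> l) = 2 * d"
    using form \<beta>(1) by (auto simp: forms_def)
  let ?N = "{l. lookup \<beta> l \<noteq> 0}"
  show ?thesis
  proof (cases "\<exists>i j. i \<noteq> j \<and> ?N \<subseteq> {i, j}")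
    case True
    then obtain i j where "i \<noteq> j" "?N \<subseteq> {i, j}"
      by blast
    then show ?thesis
      using circuit_face[OF circ I] by (intro binary_nonneg_SOS[OF form _ _ nonneg, of i j]) auto
  next
    case no_pair: False
    \<comment> \<open>For n = 1 there are no two distinct indices, so that case ends up here and is
      closed by the contradiction for pure powers.\<close>
    have "\<exists>i\<in>?N. \<exists>j\<in>?N. i \<noteq> j"
    proof (rule ccontr)
      assume "\<not> (\<exists>i\<in>?N. \<exists>j\<in>?N. i \<noteq> j)"
      then obtain i where "\<And>l. l \<noteq> i \<Longrightarrow> lookup \<beta> l = 0"
        by (metis (mono_tags, lifting) mem_Collect_eq)
      then show False
        using nonneg_form_pure_power[OF form nonneg \<beta>(1)] \<beta>(2) by auto
    qed
    then obtain i j where ij: "i \<in> ?N" "j \<in> ?N" "i \<noteq> j"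
      by blast
    with no_pair obtain k where k: "k \<in> ?N" "k \<noteq> i" "k \<noteq> j"
      by blast
    have "card {i, j, k} \<le> CARD('n)"
      by (rule card_mono) auto
    then have three: "CARD('n) \<ge> 3"
      using ij k by simp
    have "lookup \<beta> i + lookup \<beta> j + lookup \<beta> k = (\<Sum>l\<in>{i, j, k}. lookup \<beta> l)"
      using ij k by (simp add: add.assoc)
    also have "\<dots> \<le> 2 * d"
      unfolding deg[symmetric] by (rule sum_mono2) auto
    \<comment> \<open>Three positive exponents have sum at least 3, which excludes degree 2; with n
      >= 3 only ternary quartics remain.\<close>
    finally have "d \<noteq> 1"
      using ij k by auto
    with cases three have hil: "CARD('n) = 3" "d = 2"
      by (auto simp: hilbert_case_def)
    have UNIV: "UNIV = {i, j, k}"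
      using card_subset_eq[of UNIV "{i, j, k}"] ij k hil by auto
    have sum: "lookup \<beta> i + lookup \<beta> j + lookup \<beta> k = 4"
      using deg hil sum_UNIV_three[of i j k "lookup \<beta>"] UNIV ij k by auto
    have eq: "\<beta> = mono3 a b c 2 1 1"
      if "lookup \<beta> a = 2" "lookup \<beta> b = 1" "lookup \<beta> c = 1" "a \<noteq> b" "a \<noteq> c" "b \<noteq> c"
        "{a, b, c} = UNIV" for a b c
    proof (rule poly_mapping_eqI)
      fix l
      have "l \<in> {a, b, c}"
        using that by blast
      then show "lookup \<beta> l = lookup (mono3 a b c 2 1 1) l"
        using that by (auto simp: lookup_mono3)
    qed
    have SOS: "h \<in> SOS (2 * d)"
      if "lookup \<beta> a = 2" "lookup \<beta> b = 1" "lookup \<beta> c = 1" "a \<noteq> b" "a \<noteq> c" "b \<noteq> c"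
        "{a, b, c} = UNIV" for a b c
      using ternary_quartic_circuit_SOS[of a b c h] that form circ nonneg I eq[OF that] hil by auto
    have "lookup \<beta> i = 2 \<and> lookup \<beta> j = 1 \<and> lookup \<beta> k = 1 \<or>
        lookup \<beta> j = 2 \<and> lookup \<beta> i = 1 \<and> lookup \<beta> k = 1 \<or>
        lookup \<beta> k = 2 \<and> lookup \<beta> i = 1 \<and> lookup \<beta> j = 1"
      using sum ij k by simp linarith
    then show ?thesis
      using SOS[of i j k] SOS[of j i k] SOS[of k i j] ij k UNIV by auto
  qed
qed

section \<open>Sigma + C in the Hilbert cases\<close>

lemma SONC_subset_SOS:
  assumes "hilbert_case CARD('n) (2 * d) \<or> CARD('n) = 1"
  shows "(SONC (2 * d) :: 'n::finite rpoly set) \<subseteq> SOS (2 * d)"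
proof
  fix f :: "'n rpoly"
  assume "f \<in> SONC (2 * d)"
  then obtain hs where hs: "set hs \<subseteq> {h \<in> forms (2 * d). nonneg_circuit h}" "f = sum_list hs"
    by (auto simp: SONC_def)
  then have "set hs \<subseteq> SOS (2 * d)"
    using nonneg_circuit_SOS[OF _ _ assms] by blast
  then have "sum_list hs \<in> SOS (2 * d)"
    by (induction hs) (auto intro: zero_in_SOS SOS_add)
  then show "f \<in> SOS (2 * d)"
    using hs(2) by simp
qed

lemma SOS_subset: "SOS k \<subseteq> SOS_plus_SONC k"
  and SONC_subset: "SONC (2 * d) \<subseteq> SOS_plus_SONC (2 * d)"
proof -
  have "0 \<in> SONC k"
    by (auto simp: SONC_def intro!: exI[of _ "[]"])
  then show "SOS k \<subseteq> SOS_plus_SONC k"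
    by (force simp: SOS_plus_SONC_def)
  show "SONC (2 * d) \<subseteq> SOS_plus_SONC (2 * d)"
    using zero_in_SOS by (force simp: SOS_plus_SONC_def)
qed

lemma closed_Hilbert_case:
  assumes "hilbert_case CARD('n) (2 * d) \<or> CARD('n) = 1"
  shows "closed_under_linear_transformations (SOS_plus_SONC (2 * d) :: 'n::finite rpoly set)"
proof -
  have "(SOS_plus_SONC (2 * d) :: 'n rpoly set) = SOS (2 * d)"
    using SONC_subset_SOS[OF assms] SOS_subset[of "2 * d"]
    by (auto simp: SOS_plus_SONC_def intro: SOS_add)
  then show ?thesis
    by (simp add: closed_under_linear_transformations_def lin_subst_SOS)
qed

section \<open>Forms outside the Hilbert cases\<close>

text \<open>Compare the values at \<open>1\<close>, at a vector \<open>p\<close> of distinct primes and at the geometric mean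
  \<open>\<surd>p\<close> of the two: strict convexity makes the last value negative.\<close>
lemma nonneg_circuit_two_zeros:
  fixes h :: "'n::finite rpoly"
  assumes h: "nonneg_circuit h"
    and zeros: "eval h 1 = 0" "eval h (\<chi> i. real (primes_of i)) = 0"
  shows "h = 0"
proof -
  have nonneg: "eval h x \<ge> 0" for x
    using h by (simp add: nonneg_circuit_def)
  obtain \<beta> where "I_supp h \<subseteq> {\<beta>}"
    using h by (auto simp: nonneg_circuit_def circuit_def)
  then have pos: "coeff h \<alpha> > 0" if "\<alpha> \<in> supp h" "\<alpha> \<noteq> \<beta>" for \<alpha>
    using that by (auto simp: I_supp_def S_supp_def)
  define s where "s \<alpha> = (\<Prod>i\<in>UNIV. sqrt (primes_of i) ^ lookup \<alpha> i)" for \<alpha> :: "'n \<Rightarrow>\<^sub>0 nat"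
  have s2: "s \<alpha> ^ 2 = real (\<Prod>i\<in>UNIV. primes_of i ^ lookup \<alpha> i)" for \<alpha>
    by (simp add: s_def prod_power_distrib flip: power_mult)
       (simp add: mult.commute[of _ 2] power_mult)
  have s_inj: "\<alpha> = \<gamma>" if "s \<alpha> = s \<gamma>" for \<alpha> \<gamma>
    using that s2[of \<alpha>] s2[of \<gamma>] by (intro prime_power_prod_inj) (metis of_nat_eq_iff)
  have s_pos: "s \<beta> > 0"
    by (auto simp: s_def intro!: prod_pos)
  \<comment> \<open>The factor (s \<alpha> - s \<beta>)^2 cancels the only coefficient that may be
    negative. Expanded, the sum is h(p) - 2 s(\<beta>) h(sqrt p) + s(\<beta>)^2 h(1), with zero
    first and last values.\<close>
  let ?t = "\<lambda>\<alpha>. coeff h \<alpha> * (s \<alpha> - s \<beta>) ^ 2"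
  have at_1: "(\<Sum>\<alpha>\<in>supp h. coeff h \<alpha>) = 0"
    using zeros(1) by (simp add: eval_def)
  have at_p: "(\<Sum>\<alpha>\<in>supp h. coeff h \<alpha> * s \<alpha> ^ 2) = 0"
    using zeros(2) by (simp add: eval_def s2)
  have at_sqrt: "(\<Sum>\<alpha>\<in>supp h. coeff h \<alpha> * s \<alpha>) \<ge> 0"
    using nonneg[of "\<chi> i. sqrt (primes_of i)"] by (simp add: eval_def s_def)
  have "(\<Sum>\<alpha>\<in>supp h. ?t \<alpha>) = (\<Sum>\<alpha>\<in>supp h. coeff h \<alpha> * s \<alpha> ^ 2)
      - 2 * s \<beta> * (\<Sum>\<alpha>\<in>supp h. coeff h \<alpha> * s \<alpha>) + s \<beta> ^ 2 * (\<Sum>\<alpha>\<in>supp h. coeff h \<alpha>)"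
    by (simp add: sum_distrib_left sum_distrib_right power2_diff algebra_simps sum.distrib sum_subtractf)
  also have "\<dots> \<le> 0"
    using at_1 at_p at_sqrt s_pos by simp
  finally have "(\<Sum>\<alpha>\<in>supp h. ?t \<alpha>) \<le> 0" .
  moreover have t_nonneg: "?t \<alpha> \<ge> 0" if "\<alpha> \<in> supp h" for \<alpha>
    using pos[OF that] by (cases "\<alpha> = \<beta>") auto
  ultimately have t0: "\<forall>\<alpha>\<in>supp h. ?t \<alpha> = 0"
    by (subst sum_nonneg_eq_0_iff[symmetric]) (auto intro!: antisym sum_nonneg)
  have "\<alpha> = \<beta>" if "\<alpha> \<in> supp h" for \<alpha>
    using t0 that s_inj by (auto simp: in_supp_iff)
  then have "supp h \<subseteq> {\<beta>}" by blast
  then have "(\<Sum>\<alpha>\<in>supp h. coeff h \<alpha>) = (\<Sum>\<alpha>\<in>{\<beta>}. coeff h \<alpha>)"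
    by (intro sum.mono_neutral_left) (auto simp: in_supp_iff)
  then have "coeff h \<beta> = 0"
    using at_1 by simp
  then have "supp h = {}"
    using \<open>supp h \<subseteq> {\<beta>}\<close> by (auto simp: in_supp_iff)
  then show ?thesis
    by (simp add: supp_def)
qed

section \<open>Newton polytopes of sums of squares\<close>

lemma coeff_mult:
  "coeff (f * g) \<gamma> =
    (\<Sum>\<alpha>\<in>supp f. \<Sum>\<beta>\<in>supp g. if \<alpha> + \<beta> = \<gamma> then coeff f \<alpha> * coeff g \<beta> else 0)"
proof -
  have "f * g = (\<Sum>\<alpha>\<in>supp f. \<Sum>\<beta>\<in>supp g.
      Poly_Mapping.single (\<alpha> + \<beta>) (coeff f \<alpha> * coeff g \<beta>))"
    by (subst rpoly_as_sum[of f], subst rpoly_as_sum[of g])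
      (simp add: sum_product mult_single)
  then show ?thesis
    unfolding coeff_def by (simp add: lookup_sum lookup_single when_def)
qed

lemma coeff_sum_list: "coeff (sum_list fs) \<gamma> = (\<Sum>f\<leftarrow>fs. coeff f \<gamma>)"
  by (induction fs) (auto simp: coeff_def lookup_add)

text \<open>No cross term reaches \<open>\<gamma> + \<gamma>\<close>, so nothing can cancel the
  square. This applies at extreme points of the supports and at the interior exponent of Motzkin's
  form.\<close>

lemma coeff_square_unique:
  assumes "\<And>\<alpha> \<beta>. \<alpha> \<in> supp g \<Longrightarrow> \<beta> \<in> supp g \<Longrightarrow> \<alpha> + \<beta> = \<gamma> + \<gamma> \<Longrightarrow> \<alpha> = \<gamma> \<and> \<beta> = \<gamma>"
  shows "coeff (g ^ 2) (\<gamma> + \<gamma>) = coeff g \<gamma> ^ 2"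
proof -
  have "coeff (g ^ 2) (\<gamma> + \<gamma>) =
      (\<Sum>\<alpha>\<in>supp g. \<Sum>\<beta>\<in>supp g. if \<alpha> = \<gamma> then if \<beta> = \<gamma> then coeff g \<gamma> ^ 2 else 0 else 0)"
    unfolding power2_eq_square coeff_mult
  proof (intro sum.cong refl)
    fix \<alpha> \<beta> assume "\<alpha> \<in> supp g" "\<beta> \<in> supp g"
    then show "(if \<alpha> + \<beta> = \<gamma> + \<gamma> then coeff g \<alpha> * coeff g \<beta> else 0) =
        (if \<alpha> = \<gamma> then if \<beta> = \<gamma> then coeff g \<gamma> * coeff g \<gamma> else 0 else 0)"
      using assms[of \<alpha> \<beta>] by (cases "\<alpha> + \<beta> = \<gamma> + \<gamma>") auto
  qed
  also have "\<dots> = (\<Sum>\<alpha>\<in>supp g. if \<alpha> = \<gamma> then if \<gamma> \<in> supp g then coeff g \<gamma> ^ 2 else 0 else 0)"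
    by (intro sum.cong) auto
  finally show ?thesis
    by (auto simp: in_supp_iff)
qed

text \<open>An extreme point of the union of the supports has no other decomposition, so its
  double survives in the sum of the squares.\<close>
lemma sum_squares_supp:
  fixes gs :: "'n::finite rpoly list"
  assumes f: "f = (\<Sum>g\<leftarrow>gs. g ^ 2)" and "g \<in> set gs" "\<alpha> \<in> supp g"
    and bound: "\<And>\<gamma>. \<gamma> \<in> supp f \<Longrightarrow> a \<bullet> expvec \<gamma> \<le> M"
  shows "2 * (a \<bullet> expvec \<alpha>) \<le> M"
proof -
  define W where "W = (\<Union>g\<in>set gs. supp g)"
  let ?H = "convex hull (expvec ` W)"
  have "a \<bullet> e \<le> M / 2" if e: "e extreme_point_of ?H" for e
  proof -
    obtain \<epsilon> where \<epsilon>: "\<epsilon> \<in> W" "e = expvec \<epsilon>"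
      using extreme_point_of_convex_hull[OF e] by blast
    have unique: "\<beta> = \<epsilon> \<and> \<gamma> = \<epsilon>" if "\<beta> \<in> W" "\<gamma> \<in> W" "\<beta> + \<gamma> = \<epsilon> + \<epsilon>" for \<beta> \<gamma>
    proof -
      have "real (lookup \<beta> i) + real (lookup \<gamma> i) = 2 * real (lookup \<epsilon> i)" for i
        using arg_cong[OF that(3), of "\<lambda>m. real (lookup m i)"] by (simp add: lookup_add)
      then have "midpoint (expvec \<beta>) (expvec \<gamma>) = e"
        unfolding \<epsilon>(2) by (simp add: midpoint_def vec_eq_iff)
      moreover have "expvec \<beta> \<in> ?H" "expvec \<gamma> \<in> ?H"
        using that by (auto intro: hull_inc)
      ultimately have "expvec \<beta> = expvec \<gamma>"
        using e unfolding extreme_point_of_def by (metis midpoint_in_open_segment)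
      then have "\<beta> = \<gamma>"
        by (rule injD[OF inj_expvec])
      moreover have "\<beta> = \<epsilon>"
        by (rule injD[OF inj_expvec])
          (use \<open>midpoint (expvec \<beta>) (expvec \<gamma>) = e\<close> \<open>\<beta> = \<gamma>\<close> \<epsilon>(2) in simp)
      ultimately show ?thesis by simp
    qed
    have "coeff (g ^ 2) (\<epsilon> + \<epsilon>) = coeff g \<epsilon> ^ 2" if "g \<in> set gs" for g
      using that by (intro coeff_square_unique unique) (auto simp: W_def)
    then have "coeff f (\<epsilon> + \<epsilon>) = (\<Sum>g\<leftarrow>gs. coeff g \<epsilon> ^ 2)"
      by (simp add: f coeff_sum_list o_def cong: map_cong)
    moreover obtain g where g: "g \<in> set gs" "coeff g \<epsilon> \<noteq> 0"
      using \<epsilon>(1) by (auto simp: W_def in_supp_iff)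
    moreover have "coeff g \<epsilon> ^ 2 \<le> (\<Sum>g\<leftarrow>gs. coeff g \<epsilon> ^ 2)"
      using g(1) by (intro member_le_sum_list) auto
    ultimately have "\<epsilon> + \<epsilon> \<in> supp f"
      by (auto simp: in_supp_iff)
    then have "a \<bullet> expvec (\<epsilon> + \<epsilon>) \<le> M"
      by (rule bound)
    moreover have "expvec (\<epsilon> + \<epsilon>) = 2 *\<^sub>R e"
      by (simp add: \<epsilon>(2) vec_eq_iff lookup_add)
    ultimately show ?thesis
      by simp
  qed
  then have "{e. e extreme_point_of ?H} \<subseteq> {x. a \<bullet> x \<le> M / 2}"
    by blast
  then have "convex hull {e. e extreme_point_of ?H} \<subseteq> {x. a \<bullet> x \<le> M / 2}"
    by (intro hull_minimal convex_halfspace_le)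
  moreover have "?H = convex hull {e. e extreme_point_of ?H}"
    by (rule Krein_Milman_polytope) (simp add: W_def)
  moreover have "expvec \<alpha> \<in> ?H"
    using assms(2,3) by (intro hull_inc) (auto simp: W_def)
  ultimately show ?thesis
    by auto
qed

lemma sum_squares_supp_coords:
  fixes gs :: "'n::finite rpoly list"
  assumes f: "f = (\<Sum>g\<leftarrow>gs. g ^ 2)" and "g \<in> set gs" "\<alpha> \<in> supp g"
    and bound: "\<And>\<gamma>. \<gamma> \<in> supp f \<Longrightarrow>
      a * real (lookup \<gamma> i) + b * real (lookup \<gamma> j) + c * real (lookup \<gamma> k) \<le> M"
  shows "2 * (a * real (lookup \<alpha> i) + b * real (lookup \<alpha> j) + c * real (lookup \<alpha> k)) \<le> M"
proof -
  have "(axis i a + axis j b + axis k c) \<bullet> expvec \<gamma> =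
      a * real (lookup \<gamma> i) + b * real (lookup \<gamma> j) + c * real (lookup \<gamma> k)" for \<gamma> :: "'n \<Rightarrow>\<^sub>0 nat"
    by (simp add: inner_add_left inner_axis')
  then show ?thesis
    using sum_squares_supp[OF assms(1-3), of "axis i a + axis j b + axis k c" M] bound by simp
qed

text \<open>The arithmetic-geometric mean inequality with equal weights, cleared of denominators:
  the form is nonnegative when \<open>V\<close> consists of even exponents with centroid \<beta>.
  Both counterexamples have this shape.\<close>

definition agiform :: "('n \<Rightarrow>\<^sub>0 nat) set \<Rightarrow> ('n \<Rightarrow>\<^sub>0 nat) \<Rightarrow> 'n::finite rpoly" where
  "agiform V \<beta> = (\<Sum>\<alpha>\<in>V. Poly_Mapping.single \<alpha> 1) - Poly_Mapping.single \<beta> (real (card V))"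

lemma coeff_agiform:
  assumes "finite V" "\<beta> \<notin> V"
  shows "coeff (agiform V \<beta>) \<gamma> = (if \<gamma> \<in> V then 1 else if \<gamma> = \<beta> then - real (card V) else 0)"
  using assms by (auto simp: agiform_def coeff_def lookup_minus lookup_sum lookup_single when_def)

lemma supp_agiform:
  assumes "finite V" "\<beta> \<notin> V" "V \<noteq> {}"
  shows "supp (agiform V \<beta>) = insert \<beta> V"
  using assms by (auto simp: in_supp_iff coeff_agiform card_gt_0_iff split: if_splits)

lemma eval_agiform:
  assumes "finite V" "\<beta> \<notin> V"
  shows "eval (agiform V \<beta>) x = (\<Sum>\<alpha>\<in>V. \<Prod>i\<in>UNIV. x $ i ^ lookup \<alpha> i)
    - real (card V) * (\<Prod>i\<in>UNIV. x $ i ^ lookup \<beta> i)"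
  unfolding agiform_def diff_conv_add_uminus eval_add eval_uminus eval_sum eval_single by simp

text \<open>The centroid has all barycentric coordinates equal to 1 / \<open>card V\<close> > 0,
  hence lies in the relative interior of the simplex. Adding \<beta> to the support therefore
  changes neither the hull nor its vertices.\<close>

lemma circuit_agiform:
  fixes V :: "('n::finite \<Rightarrow>\<^sub>0 nat) set"
  assumes V: "finite V" "\<beta> \<notin> V" "V \<noteq> {}"
    and even: "\<And>\<alpha> i. \<alpha> \<in> V \<Longrightarrow> even (lookup \<alpha> i)"
    and centroid: "\<And>i. (\<Sum>\<alpha>\<in>V. lookup \<alpha> i) = card V * lookup \<beta> i"
    and indep: "\<And>u \<alpha>. (\<Sum>\<alpha>\<in>V. u \<alpha>) = (0::real) \<Longrightarrow>
      (\<And>i. (\<Sum>\<alpha>\<in>V. u \<alpha> * real (lookup \<alpha> i)) = 0) \<Longrightarrow> \<alpha> \<in> V \<Longrightarrow> u \<alpha> = 0"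
  shows "circuit (agiform V \<beta>)"
proof -
  let ?f = "agiform V \<beta>"
  note supp = supp_agiform[OF V]
  have S: "S_supp ?f = V"
    using even V(2) by (auto simp: S_supp_def supp coeff_agiform[OF V(1,2)] split: if_splits)
  have I: "I_supp ?f = {\<beta>}"
    using V(2) by (auto simp: I_supp_def S supp)
  have inj: "inj_on expvec V"
    using inj_expvec inj_on_subset by blast
  have card: "card V > 0"
    using V by (simp add: card_gt_0_iff)
  have "\<not> affine_dependent (expvec ` V)"
  proof
    assume "affine_dependent (expvec ` V)"
    then obtain U where U: "sum U (expvec ` V) = 0" "\<exists>v\<in>expvec ` V. U v \<noteq> 0"
      "(\<Sum>v\<in>expvec ` V. U v *\<^sub>R v) = 0"
      using affine_dependent_explicit_finite[of "expvec ` V"] V(1) by auto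
    have "U (expvec \<alpha>) = 0" if "\<alpha> \<in> V" for \<alpha>
    proof (rule indep[OF _ _ that])
      show "(\<Sum>\<alpha>\<in>V. U (expvec \<alpha>)) = 0"
        using U(1) by (simp add: sum.reindex[OF inj])
      show "(\<Sum>\<alpha>\<in>V. U (expvec \<alpha>) * real (lookup \<alpha> i)) = 0" for i
        using arg_cong[OF U(3), of "\<lambda>v. v $ i"] by (simp add: sum.reindex[OF inj] sum_component)
    qed
    then show False
      using U(2) by blast
  qed
  note indep' = this
  have bary: "(\<Sum>v\<in>expvec ` V. (1 / real (card V)) *\<^sub>R v) = expvec \<beta>"
  proof -
    have "(\<Sum>\<alpha>\<in>V. real (lookup \<alpha> i)) = card V * real (lookup \<beta> i)" for i
      using centroid[of i] by (metis of_nat_mult of_nat_sum)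
    then show ?thesis
      using card by (simp add: sum.reindex[OF inj] vec_eq_iff sum_component flip: sum_divide_distrib)
  qed
  have sum1: "(\<Sum>v\<in>expvec ` V. 1 / real (card V)) = 1"
    using card by (simp add: card_image[OF inj])
  have rel: "expvec \<beta> \<in> rel_interior (convex hull (expvec ` V))"
    unfolding rel_interior_convex_hull_explicit[OF indep']
    using bary sum1 card by (intro CollectI exI[of _ "\<lambda>_. 1 / real (card V)"]) auto
  then have "expvec \<beta> \<in> convex hull (expvec ` V)"
    using rel_interior_subset by blast
  then have New: "New ?f = convex hull (expvec ` V)"
    by (simp add: New_def supp hull_redundant)
  have "New_vertices ?f = expvec ` V"
    by (simp add: New_vertices_def New extreme_point_of_convex_hull_affine_independent[OF indep'])
  then show ?thesis
    using indep' rel by (auto simp: circuit_def S I New)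
qed

section \<open>Moving two zeros by an invertible linear map\<close>

lemma independent_pair:
  fixes x y :: "'a::real_vector"
  assumes "\<And>a b. a *\<^sub>R x + b *\<^sub>R y = 0 \<Longrightarrow> a = 0 \<and> b = 0"
  shows "independent {x, y}" "x \<noteq> y"
proof -
  have "y \<noteq> 0"
    using assms[of 0 1] by auto
  have "x \<notin> span {y}"
  proof
    assume "x \<in> span {y}"
    then obtain k where "x = k *\<^sub>R y"
      by (auto simp: span_singleton)
    then show False
      using assms[of 1 "-k"] by simp
  qed
  then show "independent {x, y}"
    using \<open>y \<noteq> 0\<close> by (simp add: independent_insert)
  show "x \<noteq> y"
    using assms[of 1 "-1"] by auto
qed

text \<open>Both pairs extend to bases of equal size, and a linear map matches one basis with the
  other. The right inverse is the relevant one, because substituting first \<open>A\<close> and then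
  \<open>B\<close> evaluates \<open>f\<close> at A (B x).\<close>

lemma invertible_map_pair:
  fixes v w y z :: "real^'n"
  assumes vw: "independent {v, w}" "v \<noteq> w" and yz: "independent {y, z}" "y \<noteq> z"
  obtains A B :: "real^'n^'n" where "A ** B = mat 1" "A *v v = y" "A *v w = z"
proof -
  obtain B1 where B1: "{v, w} \<subseteq> B1" "independent B1" "UNIV \<subseteq> span B1"
    using maximal_independent_subset_extend[of "{v, w}" UNIV] vw(1) by auto
  obtain B2 where B2: "{y, z} \<subseteq> B2" "independent B2" "UNIV \<subseteq> span B2"
    using maximal_independent_subset_extend[of "{y, z}" UNIV] yz(1) by auto
  have "card B1 = card B2"
    using B1 B2 by (metis basis_card_eq_dim subset_UNIV)
  moreover have fin: "finite B1" "finite B2"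
    using B1(2) B2(2) independent_imp_finite by auto
  ultimately have "card (B1 - {v, w}) = card (B2 - {y, z})"
    using B1(1) B2(1) vw(2) yz(2) by (simp add: card_Diff_subset)
  then obtain h where h: "bij_betw h (B1 - {v, w}) (B2 - {y, z})"
    using finite_same_card_bij fin by (metis finite_Diff)
  define \<phi> where "\<phi> x = (if x = v then y else if x = w then z else h x)" for x
  obtain g where g: "linear g" "\<And>x. x \<in> B1 \<Longrightarrow> g x = \<phi> x"
    using linear_independent_extend[OF B1(2)] by metis
  have "B2 \<subseteq> range g"
  proof
    fix b assume "b \<in> B2"
    then consider "b = y" | "b = z" | "b \<in> h ` (B1 - {v, w})"
      using h by (auto simp: bij_betw_def)
    then show "b \<in> range g"
    proof cases
      case 1
      then have "g v = b"
        using g(2)[of v] B1(1) by (simp add: \<phi>_def)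
      then show ?thesis by blast
    next
      case 2
      then have "g w = b"
        using g(2)[of w] B1(1) vw(2) by (simp add: \<phi>_def)
      then show ?thesis by blast
    next
      case 3
      then obtain x where x: "x \<in> B1 - {v, w}" "b = h x"
        by blast
      then have "g x = b"
        using g(2)[of x] by (simp add: \<phi>_def)
      then show ?thesis by blast
    qed
  qed
  then have "span B2 \<subseteq> range g"
    using g(1) by (intro span_minimal linear_subspace_image) auto
  then have "surj g"
    using B2(3) by blast
  then obtain k where k: "linear k" "g \<circ> k = id"
    using linear_surjective_right_inverse[OF g(1)] by blast
  have works: "matrix g *v x = g x" for x
    using matrix_vector_mul(2)[OF g(1)] by metis
  show ?thesis
  proof
    show "matrix g ** matrix k = mat 1"
      using k g(1) by (metis matrix_compose matrix_id_mat_1)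
    show "matrix g *v v = y"
      using g(2)[of v] B1(1) by (simp add: works \<phi>_def)
    show "matrix g *v w = z"
      using g(2)[of w] B1(1) vw(2) by (simp add: works \<phi>_def)
  qed
qed

lemma not_closed_if_two_zeros:
  fixes f :: "'n::finite rpoly" and i j :: 'n
  assumes f: "f \<in> SONC (2 * d)" "f \<notin> SOS (2 * d)" and "i \<noteq> j"
    and z: "eval f y = 0" "eval f z = 0" "independent {y, z}" "y \<noteq> z"
  shows "\<not> closed_under_linear_transformations (SOS_plus_SONC (2 * d) :: 'n rpoly set)"
proof
  assume closed: "closed_under_linear_transformations (SOS_plus_SONC (2 * d) :: 'n rpoly set)"
  define w :: "real^'n" where "w = (\<chi> i. real (primes_of i))"
  \<comment> \<open>Two distinct primes already make this vector independent of (1,...,1); this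
    takes two different variables.\<close>
  have pair: "a = 0 \<and> b = 0" if "a *\<^sub>R (1 :: real^'n) + b *\<^sub>R w = 0" for a b
  proof -
    have *: "a + b * real (primes_of l) = 0" for l :: 'n
      using that by (simp add: w_def vec_eq_iff)
    have "b * (real (primes_of i) - real (primes_of j)) = 0"
      unfolding right_diff_distrib using *[of i] *[of j] by linarith
    then have "b = 0"
      using \<open>i \<noteq> j\<close> injD[OF inj_primes_of, of i j] by auto
    then show ?thesis
      using *[of i] by simp
  qed
  obtain A B where AB: "A ** B = mat 1" "A *v 1 = y" "A *v w = z"
    using invertible_map_pair[OF independent_pair[OF pair] z(3,4)] by blast
  have "f \<in> SOS_plus_SONC (2 * d)"
    using f(1) SONC_subset by blast
  then have "lin_subst A f \<in> SOS_plus_SONC (2 * d)"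
    using closed by (simp add: closed_under_linear_transformations_def)
  then obtain g hs where g: "g \<in> SOS (2 * d)" and hs: "\<And>h. h \<in> set hs \<Longrightarrow> nonneg_circuit h"
    and eq: "lin_subst A f = g + sum_list hs"
    by (auto simp: SOS_plus_SONC_def SONC_def)
  \<comment> \<open>Nonnegative summands with total 0 are all 0, so each circuit inherits the zeros
    of the transformed form.\<close>
  have vanish: "eval h x = 0" if "h \<in> set hs" "eval f (A *v x) = 0" for h x
  proof -
    have nonneg: "eval h' x \<ge> 0" if "h' \<in> set hs" for h'
      using hs[OF that] by (simp add: nonneg_circuit_def)
    have "eval g x + (\<Sum>h\<leftarrow>hs. eval h x) = 0"
      using that(2) by (simp flip: eval_lin_subst) (simp add: eq eval_add eval_sum_list)
    moreover have "eval g x \<ge> 0"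
      using eval_SOS_nonneg[OF g] .
    moreover have "eval h x \<le> (\<Sum>h\<leftarrow>hs. eval h x)"
      using that(1) nonneg by (intro member_le_sum_list) auto
    ultimately show ?thesis
      using nonneg[OF that(1)] by linarith
  qed
  have "h = 0" if "h \<in> set hs" for h
    using that vanish z(1,2) AB(2,3) by (intro nonneg_circuit_two_zeros hs) (auto simp flip: w_def)
  then have "sum_list hs = 0"
    by (induction hs) auto
  then have "lin_subst A f \<in> SOS (2 * d)"
    using eq g by simp
  then have "lin_subst B (lin_subst A f) \<in> SOS (2 * d)"
    by (rule lin_subst_SOS)
  moreover have "lin_subst B (lin_subst A f) = f"
    by (rule eval_inject) (simp add: eval_lin_subst matrix_vector_mul_assoc AB(1))
  ultimately show False
    using f(2) by simp
qed

section \<open>Degree at least six in three or more variables: Motzkin's form\<close>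

lemma SONC_agiform:
  assumes "circuit (agiform V \<beta>)" "agiform V \<beta> \<in> forms k" "\<And>x. eval (agiform V \<beta>) x \<ge> 0"
  shows "agiform V \<beta> \<in> SONC k"
  using assms unfolding SONC_def by (auto simp: nonneg_circuit_def intro!: exI[of _ "[agiform V \<beta>]"])

text \<open>Each counterexample vanishes at (1,...,1) and is invariant under a sign change of some
  but not all of its variables, which supplies the second zero.\<close>

lemma independent_sign_flip:
  fixes y z :: "real^'n"
  assumes "y $ i = 1" "z $ i = 1" "y $ j = 1" "z $ j = -1"
  shows "independent {y, z}" "y \<noteq> z"
proof -
  have "a = 0 \<and> b = 0" if "a *\<^sub>R y + b *\<^sub>R z = 0" for a b
    using arg_cong[OF that, of "\<lambda>v. v $ i"] arg_cong[OF that, of "\<lambda>v. v $ j"] assms by simp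
  then show "independent {y, z}" "y \<noteq> z"
    using independent_pair[of y z] by blast+
qed

text \<open>For fixed s = a + b the difference of the two sides is affine in ab. It is clearly
  nonnegative for s >= 3c; otherwise ab <= s^2/4 reduces it to 4c^3 - s^2 (3c - s) = (s - 2c)^2 (s +
  c).\<close>

lemma motzkin_inequality:
  fixes a b c :: real
  assumes "a \<ge> 0" "b \<ge> 0" "c \<ge> 0"
  shows "a ^ 2 * b + a * b ^ 2 + c ^ 3 \<ge> 3 * a * b * c"
proof -
  define s where "s = a + b"
  have eq: "a ^ 2 * b + a * b ^ 2 + c ^ 3 - 3 * a * b * c = a * b * (s - 3 * c) + c ^ 3"
    by (simp add: s_def algebra_simps power2_eq_square)
  have "a * b * (s - 3 * c) + c ^ 3 \<ge> 0"
  proof (cases "s \<ge> 3 * c")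
    case False
    have "4 * (a * b) \<le> s ^ 2"
      using zero_le_power2[of "a - b"] by (simp add: s_def power2_eq_square algebra_simps)
    then have "4 * (a * b) * (3 * c - s) \<le> s ^ 2 * (3 * c - s)"
      using False by (intro mult_right_mono) auto
    moreover have "4 * c ^ 3 - s ^ 2 * (3 * c - s) = (s - 2 * c) ^ 2 * (s + c)"
      by (simp add: algebra_simps power2_eq_square power3_eq_cube)
    moreover have "(s - 2 * c) ^ 2 * (s + c) \<ge> 0"
      using assms by (simp add: s_def)
    moreover have "a * b * (s - 3 * c) = - (4 * (a * b) * (3 * c - s)) / 4"
      by (simp add: algebra_simps)
    ultimately show ?thesis
      by linarith
  qed (use assms in simp)
  then show ?thesis
    using eq by linarith
qed

text \<open>The inequalities cut out the triangle with vertices (0,0), (2,1), (1,2). Its only other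
  lattice point is (1,1), and only (1,1) + (1,1) gives (2,2).\<close>

lemma motzkin_half_points:
  fixes a b a' b' :: nat
  assumes "a \<le> 2 * b \<and> b \<le> 2 * a \<and> a + b \<le> 3" "a' \<le> 2 * b' \<and> b' \<le> 2 * a' \<and> a' + b' \<le> 3"
    "a + a' = 2" "b + b' = 2"
  shows "a = 1 \<and> b = 1"
proof -
  have "a = 0 \<or> a = 1 \<or> a = 2" "a' = 2 - a" "b = 0 \<or> b = 1 \<or> b = 2" "b' = 2 - b"
    using assms by linarith+
  with assms show ?thesis by auto
qed

text \<open>Multiplying by x_k^(2r) raises the degree from 6 to 2d. Only the exponents of x_i and
  x_j enter the polytope argument, so the extra factor does not disturb it: the coefficient -3 at
  \<beta> would have to be a sum of squares.\<close>

lemma not_closed_motzkin: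
  fixes i j k :: "'n::finite"
  assumes ij: "i \<noteq> j" "i \<noteq> k" "j \<noteq> k" and "d \<ge> 3"
  shows "\<not> closed_under_linear_transformations (SOS_plus_SONC (2 * d) :: 'n rpoly set)"
proof -
  define r where "r = d - 3"
  have d: "d = r + 3"
    using assms by (simp add: r_def)
  let ?m = "mono3 i j k"
  define V where "V = {?m 4 2 (2 * r), ?m 2 4 (2 * r), ?m 0 0 (2 * r + 6)}"
  define \<beta> where "\<beta> = ?m 2 2 (2 * r + 2)"
  let ?f = "agiform V \<beta>"
  note inject = mono3_inject[OF ij]
  have V: "finite V" "\<beta> \<notin> V" "V \<noteq> {}" "card V = 3"
    by (simp_all add: V_def \<beta>_def inject)
  have sum_V: "sum g V = g (?m 4 2 (2 * r)) + g (?m 2 4 (2 * r)) + g (?m 0 0 (2 * r + 6))"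
    for g :: "_ \<Rightarrow> 'b::comm_monoid_add"
    by (simp add: V_def inject add.assoc)
  have monom: "(\<Prod>l\<in>UNIV. x $ l ^ lookup (?m a b c) l) = x$i ^ a * x$j ^ b * x$k ^ c"
    for x :: "real^'n" and a b c
    using eval_single_mono3[OF ij, of a b c 1 x] by (simp add: eval_single)
  have eval: "eval ?f x = (x$k) ^ (2 * r) * (((x$i)^2)^2 * (x$j)^2 + (x$i)^2 * ((x$j)^2)^2
      + ((x$k)^2)^3 - 3 * (x$i)^2 * (x$j)^2 * (x$k)^2)" for x
    unfolding eval_agiform[OF V(1,2)] sum_V V(4) unfolding monom \<beta>_def
    by (simp add: algebra_simps flip: power_mult) (simp add: power_add power2_eq_square algebra_simps)
  have form: "?f \<in> forms (2 * d)"
    unfolding forms_iff_eval eval d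
    by (simp add: algebra_simps power_mult_distrib power_add flip: power_mult)
  have circ: "circuit ?f"
  proof (rule circuit_agiform[OF V(1-3)])
    show "(\<Sum>\<alpha>\<in>V. lookup \<alpha> l) = card V * lookup \<beta> l" for l
      unfolding sum_V V(4) \<beta>_def lookup_mono3 by auto
    show "even (lookup \<alpha> l)" if "\<alpha> \<in> V" for \<alpha> l
      using that by (auto simp: V_def lookup_mono3)
    fix u :: "_ \<Rightarrow> real" and \<alpha>
    assume "sum u V = 0" "\<And>l. (\<Sum>\<alpha>\<in>V. u \<alpha> * real (lookup \<alpha> l)) = 0" "\<alpha> \<in> V"
    from this(1) this(2)[of i] this(2)[of j] this(3) show "u \<alpha> = 0"
      unfolding sum_V using ij by (auto simp: V_def lookup_mono3)
  qed
  have nonneg: "eval ?f x \<ge> 0" for x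
    using motzkin_inequality[of "(x$i)^2" "(x$j)^2" "(x$k)^2"] unfolding eval by simp
  have "?f \<notin> SOS (2 * d)"
  proof
    assume "?f \<in> SOS (2 * d)"
    then obtain gs where gs: "set gs \<subseteq> forms d" "?f = (\<Sum>g\<leftarrow>gs. g ^ 2)"
      using SOS_E by metis
    let ?\<gamma> = "?m 1 1 (r + 1)"
    note coords = sum_squares_supp_coords[OF gs(2), where i = i and j = j and k = k]
    have supp: "\<gamma> \<in> {?m 4 2 (2 * r), ?m 2 4 (2 * r), ?m 0 0 (2 * r + 6), ?m 2 2 (2 * r + 2)}"
      if "\<gamma> \<in> supp ?f" for \<gamma>
      using that unfolding supp_agiform[OF V(1-3)] by (auto simp: V_def \<beta>_def)
    \<comment> \<open>Half of the Newton polytope, projected to the coordinates \<open>i\<close> and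
      \<open>j\<close>; each inequality is a supporting line.\<close>
    have constr: "lookup \<alpha> i \<le> 2 * lookup \<alpha> j \<and> lookup \<alpha> j \<le> 2 * lookup \<alpha> i \<and>
        lookup \<alpha> i + lookup \<alpha> j \<le> 3"
      if "g \<in> set gs" "\<alpha> \<in> supp g" for g \<alpha>
    proof -
      have "2 * (1 * real (lookup \<alpha> i) + (-2) * real (lookup \<alpha> j) + 0 * real (lookup \<alpha> k)) \<le> 0"
        by (rule coords[OF that], drule supp) (use ij in \<open>auto simp: lookup_mono3\<close>)
      moreover have "2 * ((-2) * real (lookup \<alpha> i) + 1 * real (lookup \<alpha> j) + 0 * real (lookup \<alpha> k)) \<le> 0"
        by (rule coords[OF that], drule supp) (use ij in \<open>auto simp: lookup_mono3\<close>)
      moreover have "2 * (1 * real (lookup \<alpha> i) + 1 * real (lookup \<alpha> j) + 0 * real (lookup \<alpha> k)) \<le> 6"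
        by (rule coords[OF that], drule supp) (use ij in \<open>auto simp: lookup_mono3\<close>)
      ultimately show ?thesis
        by auto
    qed
    have \<beta>_eq: "\<beta> = ?\<gamma> + ?\<gamma>"
      by (simp add: \<beta>_def mono3_add inject)
    have "coeff (g ^ 2) \<beta> = coeff g ?\<gamma> ^ 2" if g: "g \<in> set gs" for g
      unfolding \<beta>_eq
    proof (rule coeff_square_unique)
      fix \<alpha>1 \<alpha>2
      assume supp: "\<alpha>1 \<in> supp g" "\<alpha>2 \<in> supp g" and add: "\<alpha>1 + \<alpha>2 = ?\<gamma> + ?\<gamma>"
      have sum: "lookup \<alpha>1 l + lookup \<alpha>2 l = 2 * lookup ?\<gamma> l" for l
        using arg_cong[OF add, of "\<lambda>m. lookup m l"] by (simp add: lookup_add)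
      have "lookup \<alpha>1 i = 1 \<and> lookup \<alpha>1 j = 1"
        using motzkin_half_points[OF constr[OF g supp(1)] constr[OF g supp(2)]] sum[of i] sum[of j] ij
        by (auto simp: lookup_mono3)
      \<comment> \<open>Variables outside the triple are absent from \<beta>, hence from both
        summands; the total degree then determines the exponent of x_k.\<close>
      moreover have zero: "lookup \<alpha>1 l = 0" if "l \<notin> {i, j, k}" for l
        using sum[of l] that by (simp add: lookup_mono3)
      moreover have "(\<Sum>l\<in>UNIV. lookup \<alpha>1 l) = d"
        using gs(1) g supp(1) by (auto simp: forms_def)
      ultimately have "\<alpha>1 = ?\<gamma>"
        using sum_UNIV_three[OF ij zero] d ij
        by (intro poly_mapping_eqI) (auto simp: lookup_mono3)
      then show "\<alpha>1 = ?\<gamma> \<and> \<alpha>2 = ?\<gamma>"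
        using add by simp
    qed
    then have "coeff ?f \<beta> = (\<Sum>g\<leftarrow>gs. coeff g ?\<gamma> ^ 2)"
      by (subst gs(2)) (simp add: coeff_sum_list o_def cong: map_cong)
    moreover have "\<dots> \<ge> 0"
      by (intro sum_list_nonneg) auto
    ultimately show False
      using V by (simp add: coeff_agiform)
  qed
  moreover have "?f \<in> SONC (2 * d)"
    using SONC_agiform circ form nonneg by blast
  moreover define z :: "real^'n" where "z = (\<chi> l. if l = i then -1 else 1)"
  moreover have "independent {1, z}" "1 \<noteq> z"
    using ij independent_sign_flip[of 1 j z i] by (simp_all add: z_def)
  moreover have "eval ?f 1 = 0" "eval ?f z = 0"
    using ij by (simp_all add: eval z_def)
  ultimately show ?thesis
    using ij by (intro not_closed_if_two_zeros[of ?f d i j 1 z])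
qed

section \<open>Quartics in four or more variables: the form of Choi and Lam\<close>

definition mono4 :: "'n \<Rightarrow> 'n \<Rightarrow> 'n \<Rightarrow> 'n \<Rightarrow> nat \<Rightarrow> nat \<Rightarrow> nat \<Rightarrow> nat \<Rightarrow> ('n \<Rightarrow>\<^sub>0 nat)" where
  "mono4 i j k l a b c e = mono3 i j k a b c + Poly_Mapping.single l e"

lemma lookup_mono4:
  "lookup (mono4 i j k l a b c e) p =
    (if p = i then a else 0) + (if p = j then b else 0) + (if p = k then c else 0) + (if p = l then e else 0)"
  by (simp add: mono4_def lookup_mono3 lookup_add lookup_single when_def)

lemma mono4_inject:
  assumes "distinct [i, j, k, l]"
  shows "mono4 i j k l a b c e = mono4 i j k l a' b' c' e' \<longleftrightarrow> a = a' \<and> b = b' \<and> c = c' \<and> e = e'"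
    (is "?l = ?r \<longleftrightarrow> _")
proof
  assume "?l = ?r"
  then have "lookup ?l p = lookup ?r p" for p
    by simp
  from this[of i] this[of j] this[of k] this[of l]
  show "a = a' \<and> b = b' \<and> c = c' \<and> e = e'"
    using assms by (auto simp: lookup_mono4)
qed simp

text \<open>The arithmetic-geometric mean inequality in two rounds: pairing the four terms gives
  2|xy| w^2 and 2|xy| z^2, and then z^2 + w^2 >= 2|zw|.\<close>

lemma choi_lam_inequality:
  fixes x y z w :: real
  shows "x ^ 2 * y ^ 2 + y ^ 2 * z ^ 2 + x ^ 2 * z ^ 2 + w ^ 4 \<ge> 4 * (x * y * z * w)"
proof -
  have "2 * (\<bar>x * y\<bar> * w ^ 2) \<le> x ^ 2 * y ^ 2 + w ^ 4"
    using zero_le_power2[of "\<bar>x * y\<bar> - w ^ 2"]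
    by (simp add: power2_diff power_mult_distrib flip: power_mult)
  moreover have "2 * (\<bar>x * y\<bar> * z ^ 2) \<le> y ^ 2 * z ^ 2 + x ^ 2 * z ^ 2"
  proof -
    have "2 * (\<bar>x\<bar> * \<bar>y\<bar>) \<le> x ^ 2 + y ^ 2"
      using zero_le_power2[of "\<bar>x\<bar> - \<bar>y\<bar>"] by (simp add: power2_diff)
    then have "2 * (\<bar>x\<bar> * \<bar>y\<bar>) * z ^ 2 \<le> (x ^ 2 + y ^ 2) * z ^ 2"
      by (intro mult_right_mono) auto
    then show ?thesis
      by (simp add: abs_mult algebra_simps)
  qed
  moreover have "\<bar>x * y\<bar> * (2 * \<bar>z * w\<bar>) \<le> \<bar>x * y\<bar> * (z ^ 2 + w ^ 2)"
    using zero_le_power2[of "\<bar>z\<bar> - \<bar>w\<bar>"] by (intro mult_left_mono) (auto simp: power2_diff abs_mult)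
  moreover have "x * y * z * w \<le> \<bar>x * y\<bar> * \<bar>z * w\<bar>"
    by (metis abs_ge_self abs_mult mult.assoc)
  ultimately show ?thesis
    by (simp add: distrib_left)
qed

text \<open>The lattice points allowed by the inequalities are (0,0,0), (1,1,0), (1,0,1) and
  (0,1,1). All have even coordinate sum, whereas (1,1,1) has odd sum.\<close>

lemma choi_lam_half_points:
  fixes a b c a' b' c' :: nat
  assumes "a \<le> b + c \<and> b \<le> a + c \<and> c \<le> a + b \<and> a + b + c \<le> 2"
    "a' \<le> b' + c' \<and> b' \<le> a' + c' \<and> c' \<le> a' + b' \<and> a' + b' + c' \<le> 2"
    "a + a' = 1" "b + b' = 1" "c + c' = 1"
  shows False
proof -
  have "a = 0 \<or> a = 1" "a' = 1 - a" "b = 0 \<or> b = 1" "b' = 1 - b" "c = 0 \<or> c = 1" "c' = 1 - c"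
    using assms by linarith+
  with assms show ?thesis by auto
qed

text \<open>In contrast to Motzkin's form, \<beta> is not a sum of any two exponents available in
  the squares. Each square thus has coefficient 0 at \<beta>, while the form has coefficient
  -4.\<close>

lemma not_closed_choi_lam:
  fixes i j k l :: "'n::finite"
  assumes dist: "distinct [i, j, k, l]"
  shows "\<not> closed_under_linear_transformations (SOS_plus_SONC (2 * 2) :: 'n rpoly set)"
proof -
  let ?m = "mono4 i j k l"
  have ij: "i \<noteq> j" "i \<noteq> k" "j \<noteq> k" "i \<noteq> l" "j \<noteq> l" "k \<noteq> l"
    using dist by auto
  define V where "V = {?m 2 2 0 0, ?m 0 2 2 0, ?m 2 0 2 0, ?m 0 0 0 4}"
  define \<beta> where "\<beta> = ?m 1 1 1 1"
  let ?f = "agiform V \<beta>"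
  note inject = mono4_inject[OF dist]
  have V: "finite V" "\<beta> \<notin> V" "V \<noteq> {}" "card V = 4"
    by (simp_all add: V_def \<beta>_def inject)
  have sum_V: "sum g V = g (?m 2 2 0 0) + g (?m 0 2 2 0) + g (?m 2 0 2 0) + g (?m 0 0 0 4)"
    for g :: "_ \<Rightarrow> 'b::comm_monoid_add"
    by (simp add: V_def inject add.assoc)
  have monom: "(\<Prod>p\<in>UNIV. x $ p ^ lookup (?m a b c e) p) = x$i ^ a * x$j ^ b * x$k ^ c * x$l ^ e"
    for x :: "real^'n" and a b c e
  proof -
    have "(\<Prod>p\<in>UNIV. x $ p ^ lookup (?m a b c e) p) = (\<Prod>p\<in>{i, j, k, l}. x $ p ^ lookup (?m a b c e) p)"
      by (rule prod.mono_neutral_right) (auto simp: lookup_mono4)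
    then show ?thesis
      using ij by (simp add: lookup_mono4 mult.assoc)
  qed
  have eval: "eval ?f x = (x$i)^2 * (x$j)^2 + (x$j)^2 * (x$k)^2 + (x$i)^2 * (x$k)^2 + (x$l)^4
      - 4 * (x$i * x$j * x$k * x$l)" for x
    unfolding eval_agiform[OF V(1,2)] sum_V V(4) unfolding monom \<beta>_def by simp
  have form: "?f \<in> forms (2 * 2)"
    unfolding forms_iff_eval eval by (simp add: algebra_simps)
  have circ: "circuit ?f"
  proof (rule circuit_agiform[OF V(1-3)])
    show "(\<Sum>\<alpha>\<in>V. lookup \<alpha> p) = card V * lookup \<beta> p" for p
      unfolding sum_V V(4) \<beta>_def lookup_mono4 by auto
    show "even (lookup \<alpha> p)" if "\<alpha> \<in> V" for \<alpha> p
      using that by (auto simp: V_def lookup_mono4)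
    fix u :: "_ \<Rightarrow> real" and \<alpha>
    assume "sum u V = 0" "\<And>p. (\<Sum>\<alpha>\<in>V. u \<alpha> * real (lookup \<alpha> p)) = 0" "\<alpha> \<in> V"
    from this(1) this(2)[of i] this(2)[of j] this(2)[of k] this(2)[of l] this(3) show "u \<alpha> = 0"
      unfolding sum_V using ij by (auto simp: V_def lookup_mono4)
  qed
  have nonneg: "eval ?f x \<ge> 0" for x
    using choi_lam_inequality[of "x$i" "x$j" "x$k" "x$l"] unfolding eval by simp
  have "?f \<notin> SOS (2 * 2)"
  proof
    assume "?f \<in> SOS (2 * 2)"
    then obtain gs where gs: "?f = (\<Sum>g\<leftarrow>gs. g ^ 2)"
      using SOS_E by metis
    note coords = sum_squares_supp_coords[OF gs, where i = i and j = j and k = k]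
    have supp: "\<gamma> \<in> {?m 2 2 0 0, ?m 0 2 2 0, ?m 2 0 2 0, ?m 0 0 0 4, ?m 1 1 1 1}"
      if "\<gamma> \<in> supp ?f" for \<gamma>
      using that unfolding supp_agiform[OF V(1-3)] by (auto simp: V_def \<beta>_def)
    have constr: "lookup \<alpha> i \<le> lookup \<alpha> j + lookup \<alpha> k \<and> lookup \<alpha> j \<le> lookup \<alpha> i + lookup \<alpha> k \<and>
        lookup \<alpha> k \<le> lookup \<alpha> i + lookup \<alpha> j \<and> lookup \<alpha> i + lookup \<alpha> j + lookup \<alpha> k \<le> 2"
      if "g \<in> set gs" "\<alpha> \<in> supp g" for g \<alpha>
    proof -
      have "2 * (1 * real (lookup \<alpha> i) + (-1) * real (lookup \<alpha> j) + (-1) * real (lookup \<alpha> k)) \<le> 0"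
        by (rule coords[OF that], drule supp) (use ij in \<open>auto simp: lookup_mono4\<close>)
      moreover have "2 * ((-1) * real (lookup \<alpha> i) + 1 * real (lookup \<alpha> j) + (-1) * real (lookup \<alpha> k)) \<le> 0"
        by (rule coords[OF that], drule supp) (use ij in \<open>auto simp: lookup_mono4\<close>)
      moreover have "2 * ((-1) * real (lookup \<alpha> i) + (-1) * real (lookup \<alpha> j) + 1 * real (lookup \<alpha> k)) \<le> 0"
        by (rule coords[OF that], drule supp) (use ij in \<open>auto simp: lookup_mono4\<close>)
      moreover have "2 * (1 * real (lookup \<alpha> i) + 1 * real (lookup \<alpha> j) + 1 * real (lookup \<alpha> k)) \<le> 4"
        by (rule coords[OF that], drule supp) (use ij in \<open>auto simp: lookup_mono4\<close>)
      ultimately show ?thesis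
        by auto
    qed
    have no_sum: "\<alpha>1 + \<alpha>2 \<noteq> \<beta>" if "g \<in> set gs" "\<alpha>1 \<in> supp g" "\<alpha>2 \<in> supp g" for g \<alpha>1 \<alpha>2
    proof
      assume add: "\<alpha>1 + \<alpha>2 = \<beta>"
      have "lookup \<alpha>1 p + lookup \<alpha>2 p = lookup \<beta> p" for p
        using arg_cong[OF add, of "\<lambda>m. lookup m p"] by (simp add: lookup_add)
      from this[of i] this[of j] this[of k] show False
        using choi_lam_half_points[OF constr[OF that(1,2)] constr[OF that(1,3)]] ij
        by (auto simp: \<beta>_def lookup_mono4)
    qed
    have "coeff (g ^ 2) \<beta> = 0" if "g \<in> set gs" for g
      unfolding power2_eq_square coeff_mult using no_sum[OF that] by (intro sum.neutral ballI) auto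
    then have "coeff ?f \<beta> = 0"
      by (subst gs) (simp add: coeff_sum_list o_def cong: map_cong)
    then show False
      using V by (simp add: coeff_agiform)
  qed
  moreover have "?f \<in> SONC (2 * 2)"
    using SONC_agiform circ form nonneg by blast
  moreover define z :: "real^'n" where "z = (\<chi> p. if p = i \<or> p = j then -1 else 1)"
  moreover have "independent {1, z}" "1 \<noteq> z"
    using ij independent_sign_flip[of 1 k z i] by (simp_all add: z_def)
  moreover have "eval ?f 1 = 0" "eval ?f z = 0"
    using ij by (simp_all add: eval z_def)
  ultimately show ?thesis
    using ij by (intro not_closed_if_two_zeros[of ?f 2 i j 1 z])
qed

section \<open>Combining the cases\<close>

lemma obtain_distinct:
  assumes "CARD('n) \<ge> m"
  obtains xs :: "'n::finite list" where "distinct xs" "length xs = m"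
proof -
  obtain A :: "'n set" where A: "card A = m" "finite A"
    using assms by (metis obtain_subset_with_card_n finite)
  then show ?thesis
    using that finite_distinct_list by (metis distinct_card)
qed

theorem proposition4p12:
  fixes d :: nat
  assumes "d \<ge> 1"
  shows "closed_under_linear_transformations (SOS_plus_SONC (2 * d) :: 'n::finite rpoly set)
    \<longleftrightarrow> hilbert_case CARD('n) (2 * d) \<or> CARD('n) = 1"
proof
  assume closed: "closed_under_linear_transformations (SOS_plus_SONC (2 * d) :: 'n rpoly set)"
  show "hilbert_case CARD('n) (2 * d) \<or> CARD('n) = 1"
  proof (rule ccontr)
    assume not: "\<not> (hilbert_case CARD('n) (2 * d) \<or> CARD('n) = 1)"
    have "CARD('n) > 0"
      by simp
    with not have three: "CARD('n) \<ge> 3"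
      unfolding hilbert_case_def by linarith
    show False
    proof (cases "d \<ge> 3")
      case True
      obtain xs :: "'n list" where "distinct xs" "length xs = 3"
        using obtain_distinct[OF three] .
      then obtain i j k where "distinct [i, j, k :: 'n]"
        by (auto simp: length_Suc_conv numeral_3_eq_3)
      then show False
        using not_closed_motzkin[of i j k d] True closed by auto
    next
      case False
      with not assms have d: "d = 2" and "CARD('n) \<ge> 4"
        using three by (auto simp: hilbert_case_def)
      then obtain xs :: "'n list" where "distinct xs" "length xs = 4"
        using obtain_distinct by blast
      then obtain i j k l where "distinct [i, j, k, l :: 'n]"
        by (auto simp: length_Suc_conv numeral_eq_Suc)
      then show False
        using not_closed_choi_lam[of i j k l] closed d by auto
    qed
  qed
qed (rule closed_Hilbert_case)

end
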